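(* Let $(M^{r,3-r},\phi,\xi,\eta,g)$, $r\in\{0,1\}$, be a three-dimensional pseudo-Riemannian Sasakian space-form with $\phi$-sectional curvature $H$, and let $\psi_1,\psi_2$ be (not identically zero) Sasakian quasi-Killing spinors (SqK-spinors), each belonging to one of $\mathcal{S}_0,\mathcal{S}_+,\mathcal{S}_-$. With respect to a Sasakian frame define the complex two-form $$F_{\psi_1,\psi_2}=\frac12\sum_{j,k}\mathrm{i}\,\langle\psi_1,[\gamma_j,\gamma_k]\psi_2\rangle\,\omega^j\wedge\omega^k$$ and the Dirac-like complex current $J_{\psi_1,\psi_2}=\sum_j(-\mathrm{i})^{r-1}\langle\psi_1,\gamma^j\psi_2\rangle e_j$. Then $dF_{\psi_1,\psi_2}=0$ holds if and only if $(H,\psi_1,\psi_2)$ is one of the following cases: - $\psi_1,\psi_2\in\mathcal{S}_0$, with any $H\in\mathbb{R}$ and $r\in\{0,1\}$; - one of $\psi_1,\psi_2$ is in $\mathcal{S}_0$ and the other in $\mathcal{S}_+$, with $H=13$, $r=0$; - one of $\psi_1,\psi_2$ is in $\mathcal{S}_0$ and the other in $\mathcal{S}_-$, with $H=-13$, $r=1$; - $\psi_1,\psi_2\in\mathcal{S}_+$, with $(-1)^{r+1}H<3$; - $\psi_1,\psi_2\in\mathcal{S}_-$, with $(-1)^{r+1}H<3$ (and never when one of $\psi_1,\psi_2$ is in $\mathcal{S}_+$ and the other in $\mathcal{S}_-$). Moreover, in that situation, $F_{\psi_1,\psi_2}$ and $J_{\psi_1,\psi_2}$ satisfy $*d*F_{\psi_1,\psi_2}=(-1)^{r-1}c\;{}^\flat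 J_{\psi_1,\psi_2}$ for some $c\in\mathbb{R}$ if and only if one of the following holds: (i) $\psi_1,\psi_2\in\mathcal{S}_0$, $\psi_1$ is proportional to $\psi_2$, and both are eigen-spinors of (Clifford multiplication by) $\xi$, with $H$ arbitrary; then $c=4$. (ii) $H=(-1)^r$ and $\psi_1,\psi_2\in\mathcal{S}_0$ (that is, Killing spinors); then $c=4$. (iii) $H=13$, $r=0$, and $\psi_1\in\mathcal{S}_0,\psi_2\in\mathcal{S}_+$ or $\psi_1\in\mathcal{S}_+,\psi_2\in\mathcal{S}_0$; then $c=12$. (iv) $H=-13$, $r=1$, and $\psi_1\in\mathcal{S}_0,\psi_2\in\mathcal{S}_-$ or $\psi_1\in\mathcal{S}_-,\psi_2\in\mathcal{S}_0$; then $c=12$. (v) $\psi_1,\psi_2\in\mathcal{S}_0$ and $\langle\psi_1,\gamma_1\psi_2\rangle=0$, with $H$ arbitrary; then $c=3+(-1)^rH$.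
   Context: Write $\mathrm{i}=\sqrt{-1}$; $r=0$ is the Riemannian case and $r=1$ the Lorentzian case. A Sasakian manifold is a contact metric manifold $(M,\phi,\xi,\eta,g)$ with Reeb field $\xi$, $\eta(\xi)=1$, satisfying $R(X,Y)\xi=\eta(Y)X-\eta(X)Y$; Lorentzian-Sasakian manifolds are obtained from Riemannian ones by replacing the metric $g'$ by $g'-2\eta\otimes\eta$, so $g(\xi,\xi)=(-1)^r$. The $\phi$-sectional curvature is $K(X,\phi X)$, $X\perp\xi$; a Sasakian space-form is a simply connected Sasakian manifold with constant $\phi$-sectional curvature $H$. In dimension three there is a global orthonormal frame (Sasakian frame) $e_1=\xi,e_2,e_3$, $g(e_i,e_j)=h_{ij}$, $h=\mathrm{diag}((-1)^r,1,1)$, with $[e_1,e_2]=-\frac{H+(-1)^r3}{2}e_3$, $[e_1,e_3]=\frac{H+(-1)^r3}{2}e_2$, $[e_2,e_3]=-2e_1$; the dual coframe is $\omega^1=\eta,\omega^2,\omega^3$. Indices are raised with $h$. Spinors: with respect to a Sasakian frame spinor fields are $\mathbb{C}^2$-valued functions, and $e_j$ acts by Clifford multiplication via $\gamma_1=(-\mathrm{i})^{r-1}\sigma_1$, $\gamma_2=\mathrm{i}\sigma_2$, $\gamma_3=\mathrm{i}\sigma_3$ ($\sigma_j$ the Pauli matrices), so $X\cdot Y+Y\cdot X=-2g(X,Y)$. The spin connection is $\nabla_X\psi=X(\psi)+\omega^S(X)\psi$ with $\omega^S=\frac{(-\mathrm{i})^r}{2}\sum_j\omega^j\gamma_j+\mathrm{i}^r\frac{H+(-1)^{r-1}}{4}\omega^1\gamma_1$.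 The Spin-invariant form is $\langle\psi_1,\psi_2\rangle=\psi_1^\dagger(\gamma_1)^r\psi_2$. An SqK-spinor of type $(a,b)$, $a,b\in\mathbb{R}$, is a spinor field with $\nabla_X\psi=a\,\mathrm{i}^rX\cdot\psi+b\,\mathrm{i}^r\eta(X)\xi\cdot\psi$ for all $X$. $\mathcal{S}_0$ is the set of SqK-spinors of type $\left(\frac{(-1)^r}{2},\frac{H-(-1)^r}{4}\right)$ and, when $3+(-1)^rH>0$, $\mathcal{S}_\pm$ is the set of those of type $\left(\frac{(-1)^r\pm\sqrt{3+(-1)^rH}}{2},\frac{(-1)^{r-1}2\mp\sqrt{3+(-1)^rH}}{2}\right)$. The Hodge star convention is such that for $F=\frac12\sum F_{jk}\omega^j\wedge\omega^k$ one has $*d*F=(-1)^{r-1}\sum_{j,k}\nabla^jF_{jk}\,\omega^k$.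
   Formalization: The list (i)–(v) omits a case and is false without it: H=(-1)^r with both spinors in S_- (r=0) or both in S_+ (r=1), the Killing spinors of opposite Killing number, also satisfy the Maxwell equation, with c=-4; this case is added to the equivalence. *)

theory Defs
  imports "HOL-Analysis.Analysis"
begin

section \<open>Smooth 3-manifolds\<close>

text \<open>Class \<open>C\<^sup>k\<close> and \<open>C\<^sup>\<infinity>\<close>; only used for open \<open>S\<close>.\<close>

primrec Ck_on :: "nat \<Rightarrow> 'a::euclidean_space set \<Rightarrow> ('a \<Rightarrow> 'b::real_normed_vector) \<Rightarrow> bool" where
  "Ck_on 0 S f = continuous_on S f"
| "Ck_on (Suc k) S f =
     ((\<forall>x\<in>S. f differentiable (at x)) \<and> (\<forall>u. Ck_on k S (\<lambda>x. frechet_derivative f (at x) u)))"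

definition smooth_on :: "'a::euclidean_space set \<Rightarrow> ('a \<Rightarrow> 'b::real_normed_vector) \<Rightarrow> bool" where
  "smooth_on S f \<longleftrightarrow> (\<forall>k. Ck_on k S f)"

text \<open>The manifold is the whole topological space \<open>'m\<close>; a chart \<open>(U, x)\<close> consists of its domain
  and its coordinate map (irrelevant outside \<open>U\<close>).\<close>

type_synonym 'm chart = "'m set \<times> ('m \<Rightarrow> real^3)"

definition smooth_atlas :: "'m::{t2_space,second_countable_topology} chart set \<Rightarrow> bool" where
  "smooth_atlas A \<longleftrightarrow>
     (\<forall>(U, x)\<in>A. open U \<and> open (x ` U) \<and> homeomorphism U (x ` U) x (inv_into U x)) \<and>
     (\<Union>(U, x)\<in>A. U) = UNIV \<and>
     (\<forall>(U, x)\<in>A. \<forall>(V, y)\<in>A. smooth_on (x ` (U \<inter> V)) (\<lambda>z. y (inv_into U x z)))"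

definition smooth_fun :: "'m chart set \<Rightarrow> ('m \<Rightarrow> real) \<Rightarrow> bool" where
  "smooth_fun A f \<longleftrightarrow> (\<forall>(U, x)\<in>A. smooth_on (x ` U) (\<lambda>z. f (inv_into U x z)))"

text \<open>A tangent vector at \<open>p\<close> is a directional derivative in some chart around \<open>p\<close>, acting on the
  smooth functions. It is set to zero on non-smooth functions, so that equality of tangent vectors
  (and of vector fields) is equality in HOL.\<close>

type_synonym 'm tvec = "('m \<Rightarrow> real) \<Rightarrow> real"
type_synonym 'm vfield = "'m \<Rightarrow> 'm tvec"

definition tangent_space :: "'m chart set \<Rightarrow> 'm \<Rightarrow> 'm tvec set" where
  "tangent_space A p = {v. \<exists>(U, x)\<in>A. p \<in> U \<and> (\<exists>u::real^3. \<forall>f.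
     v f = (if smooth_fun A f
            then frechet_derivative (\<lambda>z. f (inv_into U x z)) (at (x p)) u else 0))}"

definition vfields :: "'m chart set \<Rightarrow> 'm vfield set" where
  "vfields A = {X. (\<forall>p. X p \<in> tangent_space A p) \<and>
                   (\<forall>f. smooth_fun A f \<longrightarrow> smooth_fun A (\<lambda>p. X p f))}"

definition lie_bracket :: "'m vfield \<Rightarrow> 'm vfield \<Rightarrow> 'm vfield" where
  "lie_bracket X Y = (\<lambda>p f. X p (\<lambda>q. Y q f) - Y p (\<lambda>q. X q f))"


section \<open>Metrics, connections and curvature\<close>

type_synonym 'm cotensor1 = "'m \<Rightarrow> 'm tvec \<Rightarrow> real"
type_synonym 'm cotensor2 = "'m \<Rightarrow> 'm tvec \<Rightarrow> 'm tvec \<Rightarrow> real"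
type_synonym 'm endo = "'m \<Rightarrow> 'm tvec \<Rightarrow> 'm tvec"

definition one_form :: "'m chart set \<Rightarrow> 'm cotensor1 \<Rightarrow> bool" where
  "one_form A \<alpha> \<longleftrightarrow>
     (\<forall>p. \<forall>u\<in>tangent_space A p. \<forall>v\<in>tangent_space A p. \<forall>a.
        \<alpha> p (\<lambda>f. a * u f + v f) = a * \<alpha> p u + \<alpha> p v) \<and>
     (\<forall>X\<in>vfields A. smooth_fun A (\<lambda>p. \<alpha> p (X p)))"

definition endo_field :: "'m chart set \<Rightarrow> 'm endo \<Rightarrow> bool" where
  "endo_field A \<phi> \<longleftrightarrow>
     (\<forall>p. \<forall>u\<in>tangent_space A p. \<forall>v\<in>tangent_space A p. \<forall>a.
        \<phi> p (\<lambda>f. a * u f + v f) = (\<lambda>f. a * \<phi> p u f + \<phi> p v f)) \<and>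
     (\<forall>p. \<forall>u\<in>tangent_space A p. \<phi> p u \<in> tangent_space A p) \<and>
     (\<forall>X\<in>vfields A. (\<lambda>p. \<phi> p (X p)) \<in> vfields A)"

definition riemannian_metric :: "'m chart set \<Rightarrow> 'm cotensor2 \<Rightarrow> bool" where
  "riemannian_metric A g \<longleftrightarrow>
     (\<forall>p. \<forall>u\<in>tangent_space A p. \<forall>v\<in>tangent_space A p. \<forall>w\<in>tangent_space A p. \<forall>a.
        g p (\<lambda>f. a * u f + v f) w = a * g p u w + g p v w) \<and>
     (\<forall>p. \<forall>u\<in>tangent_space A p. \<forall>v\<in>tangent_space A p. g p u v = g p v u) \<and>
     (\<forall>p. \<forall>u\<in>tangent_space A p. u \<noteq> (\<lambda>f. 0) \<longrightarrow> g p u u > 0) \<and>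
     (\<forall>X\<in>vfields A. \<forall>Y\<in>vfields A. smooth_fun A (\<lambda>p. g p (X p) (Y p)))"

definition levi_civita ::
    "'m chart set \<Rightarrow> 'm cotensor2 \<Rightarrow> ('m vfield \<Rightarrow> 'm vfield \<Rightarrow> 'm vfield) \<Rightarrow> bool" where
  "levi_civita A g D \<longleftrightarrow>
     (\<forall>X\<in>vfields A. \<forall>Y\<in>vfields A. D X Y \<in> vfields A) \<and>
     (\<forall>X\<in>vfields A. \<forall>X'\<in>vfields A. \<forall>Y\<in>vfields A. \<forall>k. smooth_fun A k \<longrightarrow>
        D (\<lambda>p f. k p * X p f + X' p f) Y = (\<lambda>p f. k p * D X Y p f + D X' Y p f)) \<and>
     (\<forall>X\<in>vfields A. \<forall>Y\<in>vfields A. \<forall>Y'\<in>vfields A. \<forall>k. smooth_fun A k \<longrightarrow>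
        D X (\<lambda>p f. k p * Y p f + Y' p f)
          = (\<lambda>p f. k p * D X Y p f + X p k * Y p f + D X Y' p f)) \<and>
     (\<forall>X\<in>vfields A. \<forall>Y\<in>vfields A.
        lie_bracket X Y = (\<lambda>p f. D X Y p f - D Y X p f)) \<and>
     (\<forall>X\<in>vfields A. \<forall>Y\<in>vfields A. \<forall>Z\<in>vfields A. \<forall>p.
        X p (\<lambda>q. g q (Y q) (Z q)) = g p (D X Y p) (Z p) + g p (Y p) (D X Z p))"

definition riemann ::
    "('m vfield \<Rightarrow> 'm vfield \<Rightarrow> 'm vfield) \<Rightarrow> 'm vfield \<Rightarrow> 'm vfield \<Rightarrow> 'm vfield \<Rightarrow> 'm vfield" where
  "riemann D X Y Z =
     (\<lambda>p f. D X (D Y Z) p f - D Y (D X Z) p f - D (lie_bracket X Y) Z p f)"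

definition sectional_curvature ::
    "'m cotensor2 \<Rightarrow> ('m vfield \<Rightarrow> 'm vfield \<Rightarrow> 'm vfield) \<Rightarrow> 'm vfield \<Rightarrow> 'm vfield \<Rightarrow> 'm \<Rightarrow> real" where
  "sectional_curvature g D X Y p =
     g p (riemann D X Y Y p) (X p) /
     (g p (X p) (X p) * g p (Y p) (Y p) - (g p (X p) (Y p))^2)"


section \<open>Complex differential forms\<close>

text \<open>Complex \<open>k\<close>-forms are given by their values on vector fields, and the exterior derivative by
  the Cartan formula without a combinatorial factor, so that
  \<open>\<alpha> \<and> \<beta> = \<alpha> \<otimes> \<beta> - \<beta> \<otimes> \<alpha>\<close> for one-forms.\<close>

type_synonym 'm cform1 = "'m vfield \<Rightarrow> 'm \<Rightarrow> complex"
type_synonym 'm cform2 = "'m vfield \<Rightarrow> 'm vfield \<Rightarrow> 'm \<Rightarrow> complex"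
type_synonym 'm cform3 = "'m vfield \<Rightarrow> 'm vfield \<Rightarrow> 'm vfield \<Rightarrow> 'm \<Rightarrow> complex"

definition cderiv :: "'m tvec \<Rightarrow> ('m \<Rightarrow> complex) \<Rightarrow> complex" where
  "cderiv v f = Complex (v (\<lambda>q. Re (f q))) (v (\<lambda>q. Im (f q)))"

definition ext_d1 :: "'m cform1 \<Rightarrow> 'm cform2" where
  "ext_d1 \<alpha> X Y p = cderiv (X p) (\<alpha> Y) - cderiv (Y p) (\<alpha> X) - \<alpha> (lie_bracket X Y) p"

definition ext_d2 :: "'m cform2 \<Rightarrow> 'm cform3" where
  "ext_d2 \<beta> X Y Z p =
     cderiv (X p) (\<beta> Y Z) - cderiv (Y p) (\<beta> X Z) + cderiv (Z p) (\<beta> X Y)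
     - \<beta> (lie_bracket X Y) Z p + \<beta> (lie_bracket X Z) Y p - \<beta> (lie_bracket Y Z) X p"


section \<open>Sasakian space-forms\<close>

text \<open>The contact condition is \<open>d\<eta>(X,Y) = g(X,\<phi>Y)\<close> for the exterior derivative normalised with
  a factor 1/2; with the normalisation of \<open>ext_d1\<close> this is \<open>d\<eta>(X,Y) = 2 g(X,\<phi>Y)\<close>.
  It is what makes the bracket \<open>[e\<^sub>2,e\<^sub>3] = -2 e\<^sub>1\<close> of a Sasakian frame come out.\<close>

definition contact_metric ::
    "'m chart set \<Rightarrow> 'm endo \<Rightarrow> 'm vfield \<Rightarrow> 'm cotensor1 \<Rightarrow> 'm cotensor2 \<Rightarrow> bool" where
  "contact_metric A \<phi> \<xi> \<eta> g \<longleftrightarrow>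
     riemannian_metric A g \<and> endo_field A \<phi> \<and> \<xi> \<in> vfields A \<and> one_form A \<eta> \<and>
     (\<forall>p. \<eta> p (\<xi> p) = 1) \<and>
     (\<forall>p. \<forall>u\<in>tangent_space A p. \<phi> p (\<phi> p u) = (\<lambda>f. - u f + \<eta> p u * \<xi> p f)) \<and>
     (\<forall>p. \<forall>u\<in>tangent_space A p. \<forall>v\<in>tangent_space A p.
        g p (\<phi> p u) (\<phi> p v) = g p u v - \<eta> p u * \<eta> p v) \<and>
     (\<forall>X\<in>vfields A. \<forall>Y\<in>vfields A. \<forall>p.
        ext_d1 (\<lambda>Z q. complex_of_real (\<eta> q (Z q))) X Y p
          = complex_of_real (2 * g p (X p) (\<phi> p (Y p))))"

definition sasakian ::
    "'m chart set \<Rightarrow> 'm endo \<Rightarrow> 'm vfield \<Rightarrow> 'm cotensor1 \<Rightarrow> 'm cotensor2 \<Rightarrow> bool" where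
  "sasakian A \<phi> \<xi> \<eta> g \<longleftrightarrow>
     contact_metric A \<phi> \<xi> \<eta> g \<and>
     (\<exists>D. levi_civita A g D \<and>
        (\<forall>X\<in>vfields A. \<forall>Y\<in>vfields A.
           riemann D X Y \<xi> = (\<lambda>p f. \<eta> p (Y p) * X p f - \<eta> p (X p) * Y p f)))"

text \<open>\<open>r = 0\<close>: Riemannian; \<open>r = 1\<close>: Lorentzian.\<close>

definition pseudo_sasakian ::
    "'m chart set \<Rightarrow> nat \<Rightarrow> 'm endo \<Rightarrow> 'm vfield \<Rightarrow> 'm cotensor1 \<Rightarrow> 'm cotensor2 \<Rightarrow> bool" where
  "pseudo_sasakian A r \<phi> \<xi> \<eta> g \<longleftrightarrow>
     r = 0 \<and> sasakian A \<phi> \<xi> \<eta> g \<or>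
     r = 1 \<and> (\<exists>g'. sasakian A \<phi> \<xi> \<eta> g' \<and>
                    g = (\<lambda>p u v. g' p u v - 2 * \<eta> p u * \<eta> p v))"

definition const_phi_sectional ::
    "'m chart set \<Rightarrow> 'm endo \<Rightarrow> 'm vfield \<Rightarrow> 'm cotensor2 \<Rightarrow> real \<Rightarrow> bool" where
  "const_phi_sectional A \<phi> \<xi> g H \<longleftrightarrow>
     (\<exists>D. levi_civita A g D \<and>
        (\<forall>X\<in>vfields A. \<forall>p. X p \<noteq> (\<lambda>f. 0) \<and> g p (X p) (\<xi> p) = 0 \<longrightarrow>
           sectional_curvature g D X (\<lambda>q. \<phi> q (X q)) p = H))"

definition sasakian_space_form ::
    "'m::{t2_space,second_countable_topology} chart set \<Rightarrow> nat \<Rightarrow> 'm endo \<Rightarrow> 'm vfield \<Rightarrow>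
     'm cotensor1 \<Rightarrow> 'm cotensor2 \<Rightarrow> real \<Rightarrow> bool" where
  "sasakian_space_form A r \<phi> \<xi> \<eta> g H \<longleftrightarrow>
     smooth_atlas A \<and> simply_connected (UNIV :: 'm set) \<and>
     pseudo_sasakian A r \<phi> \<xi> \<eta> g \<and> const_phi_sectional A \<phi> \<xi> g H"


section \<open>Sasakian frames\<close>

definition sig :: "nat \<Rightarrow> 3 \<Rightarrow> real" where
  "sig r j = (if j = 1 then (-1)^r else 1)"

definition global_frame :: "'m chart set \<Rightarrow> (3 \<Rightarrow> 'm vfield) \<Rightarrow> bool" where
  "global_frame A e \<longleftrightarrow>
     (\<forall>j. e j \<in> vfields A) \<and>
     (\<forall>p. \<forall>v\<in>tangent_space A p. \<exists>!c::real^3. v = (\<lambda>f. \<Sum>j\<in>UNIV. c $ j * e j p f))"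

text \<open>\<open>coframe e j\<close> is \<open>\<omega>\<^sup>j\<close>.\<close>

definition coframe :: "(3 \<Rightarrow> 'm vfield) \<Rightarrow> 3 \<Rightarrow> 'm cotensor1" where
  "coframe e j p v = (THE c::real^3. v = (\<lambda>f. \<Sum>k\<in>UNIV. c $ k * e k p f)) $ j"

definition sasakian_frame ::
    "'m chart set \<Rightarrow> nat \<Rightarrow> 'm vfield \<Rightarrow> 'm cotensor2 \<Rightarrow> real \<Rightarrow> (3 \<Rightarrow> 'm vfield) \<Rightarrow> bool" where
  "sasakian_frame A r \<xi> g H e \<longleftrightarrow>
     global_frame A e \<and> e 1 = \<xi> \<and>
     (\<forall>i j p. g p (e i p) (e j p) = (if i = j then sig r i else 0)) \<and>
     lie_bracket (e 1) (e 2) = (\<lambda>p f. - ((H + (-1)^r * 3) / 2) * e 3 p f) \<and>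
     lie_bracket (e 1) (e 3) = (\<lambda>p f. ((H + (-1)^r * 3) / 2) * e 2 p f) \<and>
     lie_bracket (e 2) (e 3) = (\<lambda>p f. - 2 * e 1 p f)"

text \<open>Hodge star of two-forms, \<open>(*F)\<^sub>l = (1/2) F\<^sup>j\<^sup>k \<epsilon>\<^sub>j\<^sub>k\<^sub>l\<close> with volume form
  \<open>\<omega>\<^sup>1 \<and> \<omega>\<^sup>2 \<and> \<omega>\<^sup>3\<close>. With this (usual) convention,
  \<open>* d * F = (-1)\<^sup>r\<^sup>-\<^sup>1 \<nabla>\<^sup>j F\<^sub>j\<^sub>k \<omega>\<^sup>k\<close> for the Levi-Civita connection in both signatures;
  \<open>* d *\<close> does not depend on the orientation.\<close>

definition volume_form :: "(3 \<Rightarrow> 'm vfield) \<Rightarrow> 'm vfield \<Rightarrow> 'm vfield \<Rightarrow> 'm vfield \<Rightarrow> 'm \<Rightarrow> real" where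
  "volume_form e X Y Z p =
     det ((\<chi> i j. coframe e j p ((if i = 1 then X else if i = 2 then Y else Z) p)) :: real^3^3)"

definition hodge2 :: "nat \<Rightarrow> (3 \<Rightarrow> 'm vfield) \<Rightarrow> 'm cform2 \<Rightarrow> 'm cform1" where
  "hodge2 r e \<beta> X p =
     1/2 * (\<Sum>j\<in>UNIV. \<Sum>k\<in>UNIV.
       complex_of_real (sig r j * sig r k * volume_form e (e j) (e k) X p) * \<beta> (e j) (e k) p)"


section \<open>Spinors\<close>

type_synonym 'm spinor = "'m \<Rightarrow> complex^2"

definition pauli :: "3 \<Rightarrow> complex^2^2" where
  "pauli j = (if j = 1 then vector [vector [0, 1], vector [1, 0]]
              else if j = 2 then vector [vector [0, - \<i>], vector [\<i>, 0]]
              else vector [vector [1, 0], vector [0, -1]])"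

definition gam :: "nat \<Rightarrow> 3 \<Rightarrow> complex^2^2" where
  "gam r j = map_matrix ((*) (if j = 1 then (- \<i>) powi (int r - 1) else \<i>)) (pauli j)"

definition gam_up :: "nat \<Rightarrow> 3 \<Rightarrow> complex^2^2" where
  "gam_up r j = map_matrix ((*) (complex_of_real (sig r j))) (gam r j)"

text \<open>The form \<open>\<psi>\<^sub>1\<^sup>\<dagger> (\<gamma>\<^sub>1)\<^sup>r \<psi>\<^sub>2\<close> on \<open>\<complex>\<^sup>2\<close>.\<close>

definition spin_form :: "nat \<Rightarrow> complex^2 \<Rightarrow> complex^2 \<Rightarrow> complex" where
  "spin_form r s t = (\<Sum>i\<in>UNIV. cnj (s $ i) * (((\<lambda>w. gam r 1 *v w) ^^ r) t) $ i)"

definition clifford :: "nat \<Rightarrow> (3 \<Rightarrow> 'm vfield) \<Rightarrow> 'm \<Rightarrow> 'm tvec \<Rightarrow> complex^2 \<Rightarrow> complex^2" where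
  "clifford r e p v s = (\<Sum>j\<in>UNIV. complex_of_real (coframe e j p v) *s (gam r j *v s))"

definition smooth_spinor :: "'m chart set \<Rightarrow> 'm spinor \<Rightarrow> bool" where
  "smooth_spinor A \<psi> \<longleftrightarrow>
     (\<forall>i. smooth_fun A (\<lambda>p. Re (\<psi> p $ i)) \<and> smooth_fun A (\<lambda>p. Im (\<psi> p $ i)))"

definition spin_connection ::
    "nat \<Rightarrow> real \<Rightarrow> (3 \<Rightarrow> 'm vfield) \<Rightarrow> 'm \<Rightarrow> 'm tvec \<Rightarrow> complex^2 \<Rightarrow> complex^2" where
  "spin_connection r H e p v s =
     ((- \<i>)^r / 2) *s (\<Sum>j\<in>UNIV. complex_of_real (coframe e j p v) *s (gam r j *v s))
     + (\<i>^r * complex_of_real ((H + (-1) powi (int r - 1)) / 4 * coframe e 1 p v)) *s (gam r 1 *v s)"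

definition spin_nabla ::
    "nat \<Rightarrow> real \<Rightarrow> (3 \<Rightarrow> 'm vfield) \<Rightarrow> 'm vfield \<Rightarrow> 'm spinor \<Rightarrow> 'm spinor" where
  "spin_nabla r H e X \<psi> p =
     (\<chi> i. cderiv (X p) (\<lambda>q. \<psi> q $ i)) + spin_connection r H e p (X p) (\<psi> p)"

definition sqk_spinors ::
    "'m chart set \<Rightarrow> nat \<Rightarrow> real \<Rightarrow> 'm vfield \<Rightarrow> 'm cotensor1 \<Rightarrow> (3 \<Rightarrow> 'm vfield) \<Rightarrow>
     real \<Rightarrow> real \<Rightarrow> 'm spinor set" where
  "sqk_spinors A r H \<xi> \<eta> e a b =
     {\<psi>. smooth_spinor A \<psi> \<and>
          (\<forall>X\<in>vfields A. \<forall>p.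
             spin_nabla r H e X \<psi> p =
               (complex_of_real a * \<i>^r) *s clifford r e p (X p) (\<psi> p)
               + (complex_of_real b * \<i>^r * complex_of_real (\<eta> p (X p)))
                   *s clifford r e p (\<xi> p) (\<psi> p))}"

definition S_zero ::
    "'m chart set \<Rightarrow> nat \<Rightarrow> real \<Rightarrow> 'm vfield \<Rightarrow> 'm cotensor1 \<Rightarrow> (3 \<Rightarrow> 'm vfield) \<Rightarrow> 'm spinor set" where
  "S_zero A r H \<xi> \<eta> e = sqk_spinors A r H \<xi> \<eta> e ((-1)^r / 2) ((H - (-1)^r) / 4)"

definition S_plus ::
    "'m chart set \<Rightarrow> nat \<Rightarrow> real \<Rightarrow> 'm vfield \<Rightarrow> 'm cotensor1 \<Rightarrow> (3 \<Rightarrow> 'm vfield) \<Rightarrow> 'm spinor set" where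
  "S_plus A r H \<xi> \<eta> e =
     {\<psi>. 3 + (-1)^r * H > 0 \<and>
          \<psi> \<in> sqk_spinors A r H \<xi> \<eta> e
                (((-1)^r + sqrt (3 + (-1)^r * H)) / 2)
                (((-1) powi (int r - 1) * 2 - sqrt (3 + (-1)^r * H)) / 2)}"

definition S_minus ::
    "'m chart set \<Rightarrow> nat \<Rightarrow> real \<Rightarrow> 'm vfield \<Rightarrow> 'm cotensor1 \<Rightarrow> (3 \<Rightarrow> 'm vfield) \<Rightarrow> 'm spinor set" where
  "S_minus A r H \<xi> \<eta> e =
     {\<psi>. 3 + (-1)^r * H > 0 \<and>
          \<psi> \<in> sqk_spinors A r H \<xi> \<eta> e
                (((-1)^r - sqrt (3 + (-1)^r * H)) / 2)
                (((-1) powi (int r - 1) * 2 + sqrt (3 + (-1)^r * H)) / 2)}"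

text \<open>At \<open>H = (-1)\<^sup>r\<close> the space-form has, besides the Killing spinors of \<open>S_zero\<close>
  (\<open>a = (-1)\<^sup>r / 2\<close>, \<open>b = 0\<close>), those with the opposite Killing number: since
  \<open>sqrt (3 + (-1)\<^sup>r H) = 2\<close>, the type of \<open>S_minus\<close> is \<open>(-1/2, 0)\<close> if \<open>r = 0\<close>, and that
  of \<open>S_plus\<close> is \<open>(1/2, 0)\<close> if \<open>r = 1\<close>. For two spinors of this kind \<open>F\<close> is closed and
  satisfies the Maxwell equation with \<open>c = -4\<close>. This case is missing from the classification
  (i)-(v) as stated in the literature, which is therefore false at \<open>H = (-1)\<^sup>r\<close>; it
  has to be added to that list.\<close>

definition other_killing ::
    "'m chart set \<Rightarrow> nat \<Rightarrow> real \<Rightarrow> 'm vfield \<Rightarrow> 'm cotensor1 \<Rightarrow> (3 \<Rightarrow> 'm vfield) \<Rightarrow> 'm spinor set" where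
  "other_killing A r H \<xi> \<eta> e =
     {\<psi>. H = (-1)^r \<and>
          (r = 0 \<and> \<psi> \<in> S_minus A r H \<xi> \<eta> e \<or> r = 1 \<and> \<psi> \<in> S_plus A r H \<xi> \<eta> e)}"

definition one_in_each :: "'a set \<Rightarrow> 'a set \<Rightarrow> 'a \<Rightarrow> 'a \<Rightarrow> bool" where
  "one_in_each S T x y \<longleftrightarrow> x \<in> S \<and> y \<in> T \<or> x \<in> T \<and> y \<in> S"

definition proportional :: "'m spinor \<Rightarrow> 'm spinor \<Rightarrow> bool" where
  "proportional \<psi>1 \<psi>2 \<longleftrightarrow> (\<exists>k::complex. \<forall>p. \<psi>1 p = k *s \<psi>2 p)"

definition eigen_spinor :: "nat \<Rightarrow> (3 \<Rightarrow> 'm vfield) \<Rightarrow> 'm vfield \<Rightarrow> 'm spinor \<Rightarrow> bool" where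
  "eigen_spinor r e X \<psi> \<longleftrightarrow> (\<exists>l::complex. \<forall>p. clifford r e p (X p) (\<psi> p) = l *s \<psi> p)"


section \<open>The two-form, the current and the Maxwell equation\<close>

definition F_form :: "nat \<Rightarrow> (3 \<Rightarrow> 'm vfield) \<Rightarrow> 'm spinor \<Rightarrow> 'm spinor \<Rightarrow> 'm cform2" where
  "F_form r e \<psi>1 \<psi>2 X Y p =
     1/2 * (\<Sum>j\<in>UNIV. \<Sum>k\<in>UNIV.
       \<i> * spin_form r (\<psi>1 p) ((gam r j ** gam r k - gam r k ** gam r j) *v \<psi>2 p) *
       complex_of_real (coframe e j p (X p) * coframe e k p (Y p)
                        - coframe e k p (X p) * coframe e j p (Y p)))"

text \<open>Components of the complex current \<open>J\<close> with respect to the frame, and its metric dual.\<close>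

definition J_current :: "nat \<Rightarrow> 'm spinor \<Rightarrow> 'm spinor \<Rightarrow> 3 \<Rightarrow> 'm \<Rightarrow> complex" where
  "J_current r \<psi>1 \<psi>2 j p =
     (- \<i>) powi (int r - 1) * spin_form r (\<psi>1 p) (gam_up r j *v \<psi>2 p)"

definition flat :: "'m cotensor2 \<Rightarrow> (3 \<Rightarrow> 'm vfield) \<Rightarrow> (3 \<Rightarrow> 'm \<Rightarrow> complex) \<Rightarrow> 'm cform1" where
  "flat g e J X p = (\<Sum>j\<in>UNIV. J j p * complex_of_real (g p (e j p) (X p)))"

definition closed2 :: "'m chart set \<Rightarrow> 'm cform2 \<Rightarrow> bool" where
  "closed2 A \<beta> \<longleftrightarrow>
     (\<forall>X\<in>vfields A. \<forall>Y\<in>vfields A. \<forall>Z\<in>vfields A. \<forall>p. ext_d2 \<beta> X Y Z p = 0)"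

definition maxwell ::
    "'m chart set \<Rightarrow> nat \<Rightarrow> 'm cotensor2 \<Rightarrow> (3 \<Rightarrow> 'm vfield) \<Rightarrow> 'm spinor \<Rightarrow> 'm spinor \<Rightarrow> real \<Rightarrow> bool" where
  "maxwell A r g e \<psi>1 \<psi>2 c \<longleftrightarrow>
     (\<forall>X\<in>vfields A. \<forall>p.
        hodge2 r e (ext_d1 (hodge2 r e (F_form r e \<psi>1 \<psi>2))) X p
          = (-1) powi (int r - 1) * complex_of_real c * flat g e (J_current r \<psi>1 \<psi>2) X p)"

end

(* With eps = (-1)^r, a Sasakian quasi-Killing spinor psi of one of the classes satisfies
   e_1 psi = i^r nu gamma_1 psi and e_j psi = i^r mu gamma_j psi (j = 2, 3) with (mu, nu) = (0, 0)
   on S_0 and (mu, nu) = (+-q/2, - eps q^2 / 4), q = sqrt (3 + eps H), on S_+-. Hence the frame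
   derivatives of the bilinears N = <psi1, psi2> and B_j = <psi1, gamma_j psi2> are linear in
   N and the B_j with constant coefficients. Let (mu, nu) and (mu', nu') be the types of psi1 and psi2.
   The form F has components proportional to the B_j, so dF is a multiple of
   ((nu' - nu) + 2 (mu' - mu)) N, and the Maxwell equation becomes
   (4 + 4 eps (mu + mu') - c) B_1 = 0 and
   (2 eps (nu + nu' + mu + mu') + eps H + 3 - c) B_j = 0 for j = 2, 3. By unique continuation
   neither spinor vanishes anywhere; so the B_j are nowhere all zero, and differentiating
   N = 0 (or B_1 = 0, or B_2 = B_3 = 0) rules out the degenerate solutions except for constant
   spinors, where B_2 = B_3 = 0 says that the spinors are proportional eigen-spinors of xi. *)

theory Submission
  imports Defs
begin

section \<open>Calculus on a manifold\<close>

text \<open>Tangent vectors act only on globally smooth functions and forms take arbitrary vector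
  fields, whereas the quasi-Killing equation is used along the frame; two bridges are needed. For
  unique continuation, frame derivatives must control coordinate derivatives. This takes functions
  with prescribed frame derivatives at a point, and they come from the linear independence built
  into \<open>global_frame\<close>, without bump functions. For forms, coframe components of a
  smooth field are smooth because orthonormality expresses them through \<open>g\<close>. The
  brackets then yield structure equations under which every product of two coframe elements is
  closed, so dF is the frame divergence of the components of F. On both nonconstant classes nu = -
  \<open>\<kappa>\<close> / 2, so for two spinors of one such class the \<open>\<kappa>\<close>
  coming from the brackets cancels in the Maxwell coefficients. What remains, 4 + 8 eps mu = c = 4
  eps mu, has the solution eps mu = -1, c = -4: this is the origin of the additional case of Killing
  spinors with the opposite Killing number.\<close>

lemma frechet_derivative_cong_open:
  assumes "open S" "x \<in> S" "\<And>y. y \<in> S \<Longrightarrow> f y = g y"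
  shows "frechet_derivative f (at x) = frechet_derivative g (at x)"
proof -
  have "(f has_derivative D) (at x) \<longleftrightarrow> (g has_derivative D) (at x)" for D
    using assms by (metis has_derivative_transform_within_open)
  then show ?thesis
    by (simp add: frechet_derivative_def)
qed

lemma differentiable_cong_open:
  assumes "open S" "x \<in> S" "\<And>y. y \<in> S \<Longrightarrow> f y = g y" "f differentiable (at x)"
  shows "g differentiable (at x)"
  using assms by (metis differentiable_def has_derivative_transform_within_open)

text \<open>The rules for derivatives of sums and products hold only at points of S, where the
  functions are differentiable, while the recursion of \<open>Ck_on\<close> runs through the
  derivative as a total function. Openness of S makes values outside it irrelevant.\<close>

lemma Ck_on_cong:
  assumes "open S" "\<And>x. x \<in> S \<Longrightarrow> f x = g x" "Ck_on k S f"
  shows "Ck_on k S g"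
  using assms(2,3)
proof (induction k arbitrary: f g)
  case 0
  then show ?case using continuous_on_cong[of S S f g] by simp
next
  case (Suc k)
  have eq: "frechet_derivative f (at x) u = frechet_derivative g (at x) u" if "x \<in> S" for x u
    using frechet_derivative_cong_open[OF assms(1) that Suc.prems(1)] by simp
  have "Ck_on k S (\<lambda>x. frechet_derivative g (at x) u)" for u
    by (rule Suc.IH[of "\<lambda>x. frechet_derivative f (at x) u"]) (use Suc.prems eq in auto)
  moreover have "g differentiable (at x)" if "x \<in> S" for x
    using differentiable_cong_open[OF assms(1) that Suc.prems(1)] Suc.prems(2) that by auto
  ultimately show ?case by simp
qed

lemma Ck_on_Suc_imp:
  assumes "Ck_on (Suc k) S f"
  shows "Ck_on k S f"
  using assms
proof (induction k arbitrary: f)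
  case 0
  then show ?case
    by (simp add: differentiable_imp_continuous_on differentiable_at_imp_differentiable_on)
qed auto

lemma Ck_on_const: "Ck_on k S (\<lambda>x. c)"
  by (induction k arbitrary: c) auto

lemma frechet_derivative_add:
  assumes "f differentiable (at x)" "g differentiable (at x)"
  shows "frechet_derivative (\<lambda>x. f x + g x) (at x)
    = (\<lambda>u. frechet_derivative f (at x) u + frechet_derivative g (at x) u)"
  using assms frechet_derivative_works has_derivative_add
  by (intro frechet_derivative_at[symmetric]) blast

lemma Ck_on_add:
  assumes "open S" "Ck_on k S f" "Ck_on k S g"
  shows "Ck_on k S (\<lambda>x. f x + g x)"
  using assms(2,3)
proof (induction k arbitrary: f g)
  case (Suc k)
  have "Ck_on k S (\<lambda>x. frechet_derivative (\<lambda>x. f x + g x) (at x) u)" for u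
    by (rule Ck_on_cong[OF assms(1), of "\<lambda>x. frechet_derivative f (at x) u + frechet_derivative g (at x) u"])
       (use Suc in \<open>auto simp: frechet_derivative_add\<close>)
  then show ?case using Suc.prems by auto
qed (auto intro: continuous_intros)

lemma frechet_derivative_mult:
  fixes f g :: "'a::real_normed_vector \<Rightarrow> real"
  assumes "f differentiable (at x)" "g differentiable (at x)"
  shows "frechet_derivative (\<lambda>x. f x * g x) (at x)
    = (\<lambda>u. f x * frechet_derivative g (at x) u + frechet_derivative f (at x) u * g x)"
  using assms frechet_derivative_works has_derivative_mult[of f _ x UNIV g]
  by (intro frechet_derivative_at[symmetric]) blast

lemma Ck_on_mult:
  fixes f g :: "'a::euclidean_space \<Rightarrow> real"
  assumes "open S" "Ck_on k S f" "Ck_on k S g"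
  shows "Ck_on k S (\<lambda>x. f x * g x)"
  using assms(2,3)
proof (induction k arbitrary: f g)
  case (Suc k)
  \<comment> \<open>The product rule leaves one factor undifferentiated, so the induction hypothesis
    is also applied to f and g themselves, at order k.\<close>
  have fg: "Ck_on k S f" "Ck_on k S g"
    using Suc.prems Ck_on_Suc_imp by blast+
  have "Ck_on k S (\<lambda>x. frechet_derivative (\<lambda>x. f x * g x) (at x) u)" for u
    by (rule Ck_on_cong[OF assms(1), of "\<lambda>x. f x * frechet_derivative g (at x) u + frechet_derivative f (at x) u * g x"])
       (use Suc.prems fg in \<open>auto simp: frechet_derivative_mult intro!: Ck_on_add assms(1) Suc.IH\<close>)
  then show ?case using Suc.prems by auto
qed (auto intro: continuous_intros)

lemma smooth_on_add:
  "open S \<Longrightarrow> smooth_on S f \<Longrightarrow> smooth_on S g \<Longrightarrow> smooth_on S (\<lambda>x. f x + g x)"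
  by (simp add: smooth_on_def Ck_on_add)

lemma smooth_on_mult:
  fixes f g :: "'a::euclidean_space \<Rightarrow> real"
  shows "open S \<Longrightarrow> smooth_on S f \<Longrightarrow> smooth_on S g \<Longrightarrow> smooth_on S (\<lambda>x. f x * g x)"
  by (simp add: smooth_on_def Ck_on_mult)

lemma smooth_onD:
  assumes "smooth_on S f"
  shows "\<And>x. x \<in> S \<Longrightarrow> f differentiable (at x)" "continuous_on S f"
    "continuous_on S (\<lambda>x. frechet_derivative f (at x) u)"
proof -
  have "Ck_on (Suc 0) S f" "Ck_on 0 S f" using assms smooth_on_def by blast+
  then show "\<And>x. x \<in> S \<Longrightarrow> f differentiable (at x)" "continuous_on S f"
    "continuous_on S (\<lambda>x. frechet_derivative f (at x) u)" by auto
qed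

lemma smooth_fun_const: "smooth_fun A (\<lambda>p. c)"
  by (auto simp: smooth_fun_def smooth_on_def Ck_on_const)

section \<open>Smooth functions and tangent vectors as derivations\<close>

locale manifold3 =
  fixes A :: "'m::{t2_space,second_countable_topology} chart set"
  assumes atlas: "smooth_atlas A"
begin

lemma chartD:
  assumes "(U, x) \<in> A"
  shows "open U" "open (x ` U)" "homeomorphism U (x ` U) x (inv_into U x)"
  using atlas assms by (auto simp: smooth_atlas_def)

lemma chart_exists: obtains U x where "(U, x) \<in> A" "p \<in> U"
proof -
  have "p \<in> (\<Union>(U, x)\<in>A. U)"
    using atlas by (simp add: smooth_atlas_def)
  then show thesis using that by blast
qed

lemma smooth_funD:
  assumes "smooth_fun A f" "(U, x) \<in> A"
  shows "smooth_on (x ` U) (\<lambda>z. f (inv_into U x z))"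
  using assms by (auto simp: smooth_fun_def)

lemma smooth_fun_add:
  assumes "smooth_fun A f" "smooth_fun A h"
  shows "smooth_fun A (\<lambda>p. f p + h p)"
  unfolding smooth_fun_def
proof safe
  fix U x assume U: "(U, x) \<in> A"
  show "smooth_on (x ` U) (\<lambda>z. f (inv_into U x z) + h (inv_into U x z))"
    by (intro smooth_on_add chartD(2)[OF U] smooth_funD[OF assms(1) U] smooth_funD[OF assms(2) U])
qed

lemma smooth_fun_mult:
  assumes "smooth_fun A f" "smooth_fun A h"
  shows "smooth_fun A (\<lambda>p. f p * h p)"
  unfolding smooth_fun_def
proof safe
  fix U x assume U: "(U, x) \<in> A"
  show "smooth_on (x ` U) (\<lambda>z. f (inv_into U x z) * h (inv_into U x z))"
    by (intro smooth_on_mult chartD(2)[OF U] smooth_funD[OF assms(1) U] smooth_funD[OF assms(2) U])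
qed

lemma smooth_fun_uminus:
  assumes "smooth_fun A f" shows "smooth_fun A (\<lambda>p. - f p)"
  using smooth_fun_mult[OF smooth_fun_const[of A "-1"] assms] by simp

lemma smooth_fun_diff:
  assumes "smooth_fun A f" "smooth_fun A h"
  shows "smooth_fun A (\<lambda>p. f p - h p)"
  using smooth_fun_add[OF assms(1) smooth_fun_uminus[OF assms(2)]] by simp

lemma smooth_fun_sum:
  assumes "\<And>i. i \<in> I \<Longrightarrow> smooth_fun A (f i)"
  shows "smooth_fun A (\<lambda>p. \<Sum>i\<in>I. f i p)"
  using assms
proof (induction I rule: infinite_finite_induct)
  case (insert i I)
  then show ?case using smooth_fun_add[of "f i"] by simp
qed (auto intro: smooth_fun_const)

lemma smooth_fun_continuous:
  assumes "smooth_fun A f" shows "continuous_on UNIV f"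
proof -
  have "continuous_on U f" if "(U, x) \<in> A" for U x
  proof -
    note h = chartD(3)[OF that]
    have "continuous_on (x ` U) (\<lambda>z. f (inv_into U x z))"
      using smooth_onD(2) smooth_funD[OF assms that] by blast
    moreover have "continuous_on U x" "\<And>p. p \<in> U \<Longrightarrow> inv_into U x (x p) = p"
      using h by (simp_all add: homeomorphism_def)
    ultimately have "continuous_on U ((\<lambda>z. f (inv_into U x z)) \<circ> x)"
      by (simp only: continuous_on_compose)
    then show ?thesis
      using \<open>\<And>p. p \<in> U \<Longrightarrow> inv_into U x (x p) = p\<close> by (simp cong: continuous_on_cong_simp)
  qed
  then have "continuous_on (\<Union>(U, x)\<in>A. U) f"
    using chartD(1) by (intro continuous_on_open_UN) auto
  moreover have "(\<Union>(U, x)\<in>A. U) = UNIV"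
    using atlas by (simp add: smooth_atlas_def)
  ultimately show ?thesis by simp
qed

lemma tangent_nonsmooth:
  "v \<in> tangent_space A p \<Longrightarrow> \<not> smooth_fun A f \<Longrightarrow> v f = 0"
  by (auto simp: tangent_space_def)

lemma tangentE:
  assumes "v \<in> tangent_space A p"
  obtains U x u where "(U, x) \<in> A" "p \<in> U" "inv_into U x (x p) = p"
    "\<And>f. smooth_fun A f \<Longrightarrow> (\<lambda>z. f (inv_into U x z)) differentiable (at (x p))"
    "\<And>f. smooth_fun A f \<Longrightarrow> v f = frechet_derivative (\<lambda>z. f (inv_into U x z)) (at (x p)) u"
proof -
  obtain U x u where *: "(U, x) \<in> A" "p \<in> U"
    "\<And>f. v f = (if smooth_fun A f
            then frechet_derivative (\<lambda>z. f (inv_into U x z)) (at (x p)) u else 0)"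
    using assms by (auto simp: tangent_space_def)
  show thesis
  proof (rule that[OF *(1,2)])
    show "inv_into U x (x p) = p"
      using chartD(3)[OF *(1)] *(2) by (auto simp: homeomorphism_def)
    show "(\<lambda>z. f (inv_into U x z)) differentiable (at (x p))" if "smooth_fun A f" for f
      using smooth_onD(1)[OF smooth_funD[OF that *(1)]] *(2) by blast
    show "v f = frechet_derivative (\<lambda>z. f (inv_into U x z)) (at (x p)) u" if "smooth_fun A f" for f
      using that *(3) by simp
  qed
qed

lemma tangent_const: "v \<in> tangent_space A p \<Longrightarrow> v (\<lambda>q. c) = 0"
  by (erule tangentE) (simp add: smooth_fun_const)

lemma tangent_add:
  assumes "v \<in> tangent_space A p" "smooth_fun A f" "smooth_fun A h"
  shows "v (\<lambda>q. f q + h q) = v f + v h"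
  using assms(1) by (rule tangentE)
    (use assms(2,3) in \<open>simp add: smooth_fun_add frechet_derivative_add\<close>)

lemma tangent_mult:
  assumes "v \<in> tangent_space A p" "smooth_fun A f" "smooth_fun A h"
  shows "v (\<lambda>q. f q * h q) = f p * v h + v f * h p"
  using assms(1) by (rule tangentE)
    (use assms(2,3) in \<open>simp add: smooth_fun_mult frechet_derivative_mult\<close>)

lemma tangent_uminus:
  assumes "v \<in> tangent_space A p" "smooth_fun A f"
  shows "v (\<lambda>q. - f q) = - v f"
  using tangent_mult[OF assms(1) smooth_fun_const[of A "-1"] assms(2)] tangent_const[OF assms(1)] by simp

lemma tangent_diff:
  assumes "v \<in> tangent_space A p" "smooth_fun A f" "smooth_fun A h"
  shows "v (\<lambda>q. f q - h q) = v f - v h"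
  using tangent_add[OF assms(1,2) smooth_fun_uminus[OF assms(3)]] tangent_uminus[OF assms(1,3)] by simp

lemma tangent_sum:
  assumes "v \<in> tangent_space A p" "\<And>i. i \<in> I \<Longrightarrow> smooth_fun A (f i)"
  shows "v (\<lambda>q. \<Sum>i\<in>I. f i q) = (\<Sum>i\<in>I. v (f i))"
  using assms(2)
proof (induction I rule: infinite_finite_induct)
  case (insert i I)
  then show ?case using tangent_add[OF assms(1), of "f i"] by (simp add: smooth_fun_sum)
qed (auto simp: tangent_const[OF assms(1)])

end

section \<open>Frames and unique continuation\<close>

locale framed = manifold3 A for A :: "'m::{t2_space,second_countable_topology} chart set" +
  fixes e :: "3 \<Rightarrow> 'm vfield"
  assumes frame: "global_frame A e"
begin

lemma frame_vfield: "e j \<in> vfields A"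
  using frame by (simp add: global_frame_def)

lemma frame_tangent: "e j p \<in> tangent_space A p"
  using frame_vfield by (simp add: vfields_def)

lemma frame_smooth: "smooth_fun A f \<Longrightarrow> smooth_fun A (\<lambda>p. e j p f)"
  using frame_vfield by (simp add: vfields_def)

text \<open>Adding a vanishing combination to the obvious expansion of \<open>e 1\<close> would give
  it a second one. Testing on smooth functions suffices, as tangent vectors are zero on all
  others.\<close>

lemma frame_independent:
  assumes "\<And>f. smooth_fun A f \<Longrightarrow> (\<Sum>j\<in>UNIV. c $ j * e j p f) = 0"
  shows "c = (0::real^3)"
proof -
  have c: "(\<Sum>j\<in>UNIV. c $ j * e j p f) = 0" for f
    using assms tangent_nonsmooth[OF frame_tangent] by (cases "smooth_fun A f") simp_all
  have u: "\<exists>!c::real^3. e 1 p = (\<lambda>f. \<Sum>j\<in>UNIV. c $ j * e j p f)"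
    using frame frame_tangent by (simp add: global_frame_def)
  have 1: "e 1 p = (\<lambda>f. \<Sum>j\<in>UNIV. axis 1 1 $ j * e j p f)"
    by (simp add: sum_3 axis_def)
  have 2: "e 1 p = (\<lambda>f. \<Sum>j\<in>UNIV. (axis 1 1 + c) $ j * e j p f)"
    using c by (simp add: distrib_right sum.distrib flip: 1)
  have "axis 1 1 + c = axis 1 1"
    using u 1 2 by blast
  then show ?thesis by simp
qed

lemma coframe_eqI:
  assumes "\<And>f. v f = (\<Sum>j\<in>UNIV. c j * e j p f)"
  shows "coframe e j p v = c j"
proof -
  have "(THE d::real^3. v = (\<lambda>f. \<Sum>k\<in>UNIV. d $ k * e k p f)) = (\<chi> k. c k)"
  proof (rule the_equality)
    show "v = (\<lambda>f. \<Sum>k\<in>UNIV. (\<chi> k. c k) $ k * e k p f)"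
      using assms by auto
    fix d :: "real^3" assume d: "v = (\<lambda>f. \<Sum>k\<in>UNIV. d $ k * e k p f)"
    have "(\<Sum>j\<in>UNIV. (d - (\<chi> k. c k)) $ j * e j p f) = 0" for f
      using fun_cong[OF d, of f] assms[of f] by (simp add: left_diff_distrib sum_subtractf)
    then have "d - (\<chi> k. c k) = 0"
      by (rule frame_independent)
    then show "d = (\<chi> k. c k)" by simp
  qed
  then show ?thesis by (simp add: coframe_def)
qed

lemma coframe_frame: "coframe e j p (e k p) = (if j = k then 1 else 0)"
  by (rule coframe_eqI) (simp add: if_distrib[of "\<lambda>x. x * _"] cong: if_cong)

lemma tangent_decomp:
  assumes "v \<in> tangent_space A p"
  shows "v f = (\<Sum>j\<in>UNIV. coframe e j p v * e j p f)"
proof -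
  obtain c :: "real^3" where c: "v = (\<lambda>f. \<Sum>j\<in>UNIV. c $ j * e j p f)"
    using frame assms unfolding global_frame_def by blast
  have "coframe e j p v = c $ j" for j
    by (rule coframe_eqI) (simp add: c)
  then show ?thesis using c by simp
qed

text \<open>The triples of frame derivatives at p of smooth functions form a subspace of
  \<open>real^3\<close>. A nonzero vector orthogonal to it would be a linear relation between the
  frame vectors, so the subspace is everything and contains the standard basis.\<close>

lemma dual_functions_exist:
  obtains h :: "3 \<Rightarrow> 'm \<Rightarrow> real" where "\<And>k. smooth_fun A (h k)"
    "\<And>j k. e j p (h k) = (if j = k then 1 else 0)"
proof -
  define T where "T = (\<lambda>f. \<chi> j. e j p f)"
  define S where "S = T ` {f. smooth_fun A f}"
  have sub: "subspace S"
  proof (rule subspaceI)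
    show "0 \<in> S"
      unfolding S_def
      by (rule image_eqI[of _ _ "\<lambda>q. 0"])
        (simp_all add: T_def vec_eq_iff tangent_const[OF frame_tangent] smooth_fun_const)
    show "x + y \<in> S" if "x \<in> S" "y \<in> S" for x y
    proof -
      from that obtain f h where "smooth_fun A f" "smooth_fun A h" "x = T f" "y = T h"
        unfolding S_def by blast
      then show ?thesis
        unfolding S_def
        by (intro image_eqI[of _ _ "\<lambda>q. f q + h q"])
          (simp_all add: T_def vec_eq_iff tangent_add[OF frame_tangent] smooth_fun_add)
    qed
    show "c *\<^sub>R x \<in> S" if "x \<in> S" for x c
    proof -
      from that obtain f where "smooth_fun A f" "x = T f"
        unfolding S_def by blast
      then show ?thesis
        unfolding S_def
        by (intro image_eqI[of _ _ "\<lambda>q. c * f q"])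
          (simp_all add: T_def vec_eq_iff tangent_mult[OF frame_tangent]
            tangent_const[OF frame_tangent] smooth_fun_mult smooth_fun_const)
    qed
  qed
  have "S = UNIV"
  proof (rule ccontr)
    assume "S \<noteq> UNIV"
    then have "span S \<noteq> UNIV" using sub by (simp add: span_eq_iff[THEN iffD2])
    then obtain c where c: "c \<noteq> 0" "\<forall>x\<in>span S. c \<bullet> x = 0"
      using span_not_UNIV_orthogonal[of S] by blast
    have "(\<Sum>j\<in>UNIV. c $ j * e j p f) = 0" if "smooth_fun A f" for f
    proof -
      have "T f \<in> span S" using that by (auto simp: S_def intro: span_base)
      then have "c \<bullet> T f = 0" using c(2) by blast
      then show ?thesis by (simp add: inner_vec_def T_def)
    qed
    then show False using frame_independent c(1) by blast
  qed
  have "\<exists>f. smooth_fun A f \<and> T f = axis k 1" for k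
  proof -
    have "axis k 1 \<in> S" by (simp add: \<open>S = UNIV\<close>)
    then show ?thesis unfolding S_def by auto
  qed
  then obtain h where h: "\<And>k. smooth_fun A (h k)" "\<And>k. T (h k) = axis k 1"
    by metis
  show thesis
  proof (rule that[OF h(1)])
    show "e j p (h k) = (if j = k then 1 else 0)" for j k
      using arg_cong[OF h(2)[of k], of "\<lambda>v. v $ j"] by (simp add: T_def axis_def)
  qed
qed

text \<open>With functions \<open>h\<^sub>k\<close> dual to the frame at \<open>p\<close>, the frame components \<open>a\<^sub>j\<close> of a coordinate
  direction \<open>u\<close> solve \<open>\<partial>\<^sub>u h\<^sub>k = \<Sum>\<^sub>j a\<^sub>j e\<^sub>j h\<^sub>k\<close>, where the matrix \<open>e\<^sub>j h\<^sub>k\<close> is close to the identity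
  near \<open>p\<close>.\<close>

lemma coordinate_derivative_bound:
  assumes U: "(U, x) \<in> A" "p \<in> U"
  obtains d K where "d > 0" "K \<ge> 0" "cball (x p) d \<subseteq> x ` U"
    "\<And>z u f c. z \<in> cball (x p) d \<Longrightarrow> smooth_fun A f \<Longrightarrow>
       (\<And>j. \<bar>e j (inv_into U x z) f\<bar> \<le> c) \<Longrightarrow>
       \<bar>frechet_derivative (\<lambda>z. f (inv_into U x z)) (at z) u\<bar> \<le> K * norm u * c"
proof -
  define w where "w = x p"
  define W where "W = x ` U"
  define y where "y = inv_into U x"
  have W: "open W" "w \<in> W" using chartD(2)[OF U(1)] U(2) by (auto simp: W_def w_def)
  have yw: "y w = p" and yW: "\<And>z. z \<in> W \<Longrightarrow> y z \<in> U \<and> x (y z) = z"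
    using chartD(3)[OF U(1)] U(2) by (auto simp: homeomorphism_def y_def w_def W_def)
  have sm: "smooth_on W (\<lambda>z. f (y z))" if "smooth_fun A f" for f
    using smooth_funD[OF that U(1)] by (simp add: W_def y_def)
  obtain h where h: "\<And>k. smooth_fun A (h k)"
    "\<And>j k. e j p (h k) = (if j = k then 1 else 0)"
    using dual_functions_exist by blast
  define dl where "dl = (\<lambda>j k::3. if j = k then 1 else 0 :: real)"
  \<comment> \<open>E is the total deviation of the matrix of derivatives from the identity. Below
    1/2, the error term in the equations for the components a is at most half of their absolute sum
    and can be absorbed; this produces the factor 2 in \<open>2 * K0\<close>.\<close>
  define E where "E = (\<lambda>z. \<Sum>j\<in>UNIV. \<Sum>k\<in>UNIV. \<bar>e j (y z) (h k) - dl j k\<bar>)"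
  define B where "B = (\<lambda>z. \<Sum>k\<in>UNIV. \<Sum>b\<in>Basis. \<bar>frechet_derivative (\<lambda>z. h k (y z)) (at z) b\<bar>)"
  have "continuous_on W E"
    unfolding E_def by (intro continuous_intros smooth_onD(2) sm frame_smooth h)
  then have "open (W \<inter> E -` {..<1/2})"
    by (intro continuous_open_preimage W(1)) auto
  moreover have "w \<in> W \<inter> E -` {..<1/2}"
    using W(2) h(2) by (simp add: E_def yw dl_def)
  ultimately obtain d where d: "d > 0" "cball w d \<subseteq> W \<inter> E -` {..<1/2}"
    by (meson open_contains_cball)
  have "continuous_on (cball w d) B"
    unfolding B_def by (rule continuous_on_subset[of W])
      (intro continuous_intros smooth_onD(3) sm h, use d in auto)
  then have "bounded (B ` cball w d)"
    by (intro compact_imp_bounded compact_continuous_image) auto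
  then obtain K0 where "K0 > 0" "\<forall>b\<in>B ` cball w d. norm b \<le> K0"
    unfolding bounded_pos by blast
  then have K0: "\<And>z. z \<in> cball w d \<Longrightarrow> \<bar>B z\<bar> \<le> K0" "K0 > 0" by auto
  have main: "\<bar>frechet_derivative (\<lambda>z. f (y z)) (at z) u\<bar> \<le> 2 * K0 * norm u * c"
    if z: "z \<in> cball w d" and f: "smooth_fun A f" and c: "\<And>j. \<bar>e j (y z) f\<bar> \<le> c" for z u f c
  proof -
    have zW: "z \<in> W" and Ez: "E z < 1/2" using z d(2) by auto
    \<comment> \<open>The coordinate direction u as an element of the tangent space, with the
      default value 0 on non-smooth functions that membership requires.\<close>
    define v where "v = (\<lambda>f. if smooth_fun A f
      then frechet_derivative (\<lambda>z. f (y z)) (at z) u else 0)"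
    have v: "v \<in> tangent_space A (y z)"
    proof -
      have "\<exists>u'. \<forall>f. v f = (if smooth_fun A f
          then frechet_derivative (\<lambda>z. f (inv_into U x z)) (at (x (y z))) u' else 0)"
        using yW[OF zW] by (intro exI[of _ u]) (simp add: v_def y_def)
      then show ?thesis
        unfolding tangent_space_def using U(1) yW[OF zW] by blast
    qed
    define a where "a = (\<lambda>j. coframe e j (y z) v)"
    have va: "v f = (\<Sum>j\<in>UNIV. a j * e j (y z) f)" for f
      unfolding a_def by (rule tangent_decomp[OF v])
    have "\<bar>v (h k)\<bar> \<le> norm u * (\<Sum>b\<in>Basis. \<bar>frechet_derivative (\<lambda>z. h k (y z)) (at z) b\<bar>)" for k
    proof -
      have lin: "linear (frechet_derivative (\<lambda>z. h k (y z)) (at z))"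
        using smooth_onD(1)[OF sm[OF h(1)] zW] by (rule linear_frechet_derivative)
      have "v (h k) = (\<Sum>b\<in>Basis. (u \<bullet> b) * frechet_derivative (\<lambda>z. h k (y z)) (at z) b)"
        using h(1) unfolding v_def
        by (subst euclidean_representation[of u, symmetric])
          (simp add: linear_sum[OF lin] linear_cmul[OF lin])
      then have "\<bar>v (h k)\<bar> \<le> (\<Sum>b\<in>Basis. \<bar>(u \<bullet> b) * frechet_derivative (\<lambda>z. h k (y z)) (at z) b\<bar>)"
        by simp
      also have "\<dots> \<le> (\<Sum>b\<in>Basis. norm u * \<bar>frechet_derivative (\<lambda>z. h k (y z)) (at z) b\<bar>)"
        by (intro sum_mono) (auto simp: abs_mult intro!: mult_right_mono Basis_le_norm)
      finally show ?thesis by (simp add: sum_distrib_left)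
    qed
    then have "(\<Sum>k\<in>UNIV. \<bar>v (h k)\<bar>) \<le> norm u * B z"
      unfolding B_def sum_distrib_left[of _ _ UNIV] by (rule sum_mono)
    also have "\<dots> \<le> norm u * K0"
      using K0(1)[OF z] by (intro mult_left_mono) auto
    finally have vh: "(\<Sum>k\<in>UNIV. \<bar>v (h k)\<bar>) \<le> norm u * K0" .
    have "\<bar>a k\<bar> \<le> \<bar>v (h k)\<bar> + (\<Sum>j\<in>UNIV. \<bar>a j\<bar> * \<bar>e j (y z) (h k) - dl j k\<bar>)" for k
    proof -
      have "(\<Sum>j\<in>UNIV. a j * dl j k) = a k"
        by (simp add: dl_def if_distrib cong: if_cong)
      then have "a k = v (h k) - (\<Sum>j\<in>UNIV. a j * (e j (y z) (h k) - dl j k))"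
        by (simp add: va right_diff_distrib sum_subtractf)
      moreover have "\<bar>\<Sum>j\<in>UNIV. a j * (e j (y z) (h k) - dl j k)\<bar>
          \<le> (\<Sum>j\<in>UNIV. \<bar>a j\<bar> * \<bar>e j (y z) (h k) - dl j k\<bar>)"
        by (rule order_trans[OF sum_abs]) (simp add: abs_mult)
      ultimately show ?thesis by linarith
    qed
    then have "(\<Sum>k\<in>UNIV. \<bar>a k\<bar>) \<le> (\<Sum>k\<in>UNIV. \<bar>v (h k)\<bar> +
        (\<Sum>j\<in>UNIV. \<bar>a j\<bar> * \<bar>e j (y z) (h k) - dl j k\<bar>))"
      by (rule sum_mono)
    also have "\<dots> = (\<Sum>k\<in>UNIV. \<bar>v (h k)\<bar>)
        + (\<Sum>j\<in>UNIV. \<bar>a j\<bar> * (\<Sum>k\<in>UNIV. \<bar>e j (y z) (h k) - dl j k\<bar>))"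
      by (simp add: sum.distrib sum_distrib_left) (rule sum.swap)
    also have "(\<Sum>j\<in>UNIV. \<bar>a j\<bar> * (\<Sum>k\<in>UNIV. \<bar>e j (y z) (h k) - dl j k\<bar>)) \<le> (\<Sum>j\<in>UNIV. \<bar>a j\<bar> * (1/2))"
    proof (intro sum_mono mult_left_mono)
      fix j
      have "(\<Sum>k\<in>UNIV. \<bar>e j (y z) (h k) - dl j k\<bar>) \<le> E z"
        unfolding E_def
        by (rule member_le_sum[of j UNIV "\<lambda>j. \<Sum>k\<in>UNIV. \<bar>e j (y z) (h k) - dl j k\<bar>"])
          (auto intro: sum_nonneg)
      then show "(\<Sum>k\<in>UNIV. \<bar>e j (y z) (h k) - dl j k\<bar>) \<le> 1/2" using Ez by linarith
    qed auto
    also have "\<dots> = (\<Sum>j\<in>UNIV. \<bar>a j\<bar>) / 2"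
      by (simp add: sum_divide_distrib)
    finally have "(\<Sum>k\<in>UNIV. \<bar>a k\<bar>) \<le> 2 * (norm u * K0)"
      using vh by linarith
    then have a: "(\<Sum>k\<in>UNIV. \<bar>a k\<bar>) \<le> 2 * K0 * norm u"
      by (simp only: mult_ac)
    have "\<bar>v f\<bar> \<le> (\<Sum>j\<in>UNIV. \<bar>a j * e j (y z) f\<bar>)"
      unfolding va by (rule sum_abs)
    also have "\<dots> \<le> (\<Sum>j\<in>UNIV. \<bar>a j\<bar> * c)"
      by (intro sum_mono) (simp add: abs_mult mult_left_mono c)
    also have "\<dots> \<le> 2 * K0 * norm u * c"
      unfolding sum_distrib_right[symmetric]
      by (intro mult_right_mono a) (use c[of 1] in linarith)
    finally show ?thesis using f by (simp add: v_def)
  qed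
  show thesis
    by (rule that[of d "2 * K0"]) (use d K0(2) main in \<open>auto simp: w_def W_def y_def\<close>)
qed

text \<open>A discrete Gronwall argument: on a small ball around p the mean value inequality bounds
  the sum of the absolute values by \<open>L * t\<close> times its own maximum. With
  \<open>L * t < 1\<close> the maximum is zero.\<close>

lemma zero_set_open:
  fixes \<phi> :: "'i \<Rightarrow> 'm \<Rightarrow> real"
  assumes I: "finite I" and sm: "\<And>i. i \<in> I \<Longrightarrow> smooth_fun A (\<phi> i)"
    and bound: "\<And>i j p. i \<in> I \<Longrightarrow> \<bar>e j p (\<phi> i)\<bar> \<le> C * (\<Sum>k\<in>I. \<bar>\<phi> k p\<bar>)" and "C \<ge> 0"
    and p: "\<And>i. i \<in> I \<Longrightarrow> \<phi> i p = 0"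
  shows "\<exists>V. open V \<and> p \<in> V \<and> (\<forall>q\<in>V. \<forall>i\<in>I. \<phi> i q = 0)"
proof -
  obtain U x where U: "(U, x) \<in> A" "p \<in> U" using chart_exists by blast
  obtain d K where d: "d > 0" "K \<ge> 0" "cball (x p) d \<subseteq> x ` U" and
    bd: "\<And>z u f c. z \<in> cball (x p) d \<Longrightarrow> smooth_fun A f \<Longrightarrow>
       (\<And>j. \<bar>e j (inv_into U x z) f\<bar> \<le> c) \<Longrightarrow>
       \<bar>frechet_derivative (\<lambda>z. f (inv_into U x z)) (at z) u\<bar> \<le> K * norm u * c"
    using coordinate_derivative_bound[OF U] by metis
  define y where "y = inv_into U x"
  define \<Phi> where "\<Phi> = (\<lambda>z. \<Sum>k\<in>I. \<bar>\<phi> k (y z)\<bar>)"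
  have yp: "y (x p) = p" and yx: "\<And>q. q \<in> U \<Longrightarrow> y (x q) = q"
    using chartD(3)[OF U(1)] U(2) by (auto simp: homeomorphism_def y_def)
  define L where "L = real (card I) * (K * C)"
  have "L \<ge> 0" using d(2) \<open>C \<ge> 0\<close> by (simp add: L_def)
  \<comment> \<open>The summand 1 keeps the denominator positive when L = 0; in all cases
    \<open>L * t\<close> stays below 1/2.\<close>
  define t where "t = min d (1 / (2 * (L + 1)))"
  have t: "t > 0" "t \<le> d" using d(1) \<open>L \<ge> 0\<close> by (auto simp: t_def)
  have "L * t \<le> L * (1 / (2 * (L + 1)))"
    using \<open>L \<ge> 0\<close> by (intro mult_left_mono) (auto simp: t_def)
  also have "\<dots> < 1" using \<open>L \<ge> 0\<close> by (simp add: field_simps)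
  finally have Lt: "L * t < 1" .
  have cb: "cball (x p) t \<subseteq> cball (x p) d" using t by auto
  have smz: "smooth_on (x ` U) (\<lambda>z. \<phi> i (y z))" if "i \<in> I" for i
    using smooth_funD[OF sm[OF that] U(1)] by (simp add: y_def)
  have "continuous_on (cball (x p) t) \<Phi>"
    unfolding \<Phi>_def
    by (rule continuous_on_subset[of "x ` U"])
      (intro continuous_intros smooth_onD(2) smz, use cb d(3) in auto)
  then obtain z0 where z0: "z0 \<in> cball (x p) t" "\<And>z. z \<in> cball (x p) t \<Longrightarrow> \<Phi> z \<le> \<Phi> z0"
    using continuous_attains_sup[of "cball (x p) t" \<Phi>] t by auto
  have \<Phi>0: "\<Phi> z \<ge> 0" for z by (simp add: \<Phi>_def sum_nonneg)
  have "\<bar>\<phi> i (y z)\<bar> \<le> K * C * \<Phi> z0 * t" if i: "i \<in> I" and z: "z \<in> cball (x p) t" for i z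
  proof -
    have der: "((\<lambda>z. \<phi> i (y z)) has_derivative frechet_derivative (\<lambda>z. \<phi> i (y z)) (at z'))
        (at z' within cball (x p) t)" if "z' \<in> cball (x p) t" for z'
    proof -
      have "z' \<in> x ` U" using that cb d(3) by blast
      then have "(\<lambda>z. \<phi> i (y z)) differentiable (at z')"
        by (rule smooth_onD(1)[OF smz[OF i]])
      then show ?thesis
        unfolding frechet_derivative_works by (rule has_derivative_at_withinI)
    qed
    have on: "onorm (frechet_derivative (\<lambda>z. \<phi> i (y z)) (at z')) \<le> K * C * \<Phi> z0"
      if z': "z' \<in> cball (x p) t" for z'
    proof (rule onorm_le)
      fix u
      have "\<bar>frechet_derivative (\<lambda>z. \<phi> i (y z)) (at z') u\<bar> \<le> K * norm u * (C * \<Phi> z')"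
        using bd[of z' "\<phi> i" "C * \<Phi> z'" u] z' cb sm[OF i] bound[OF i]
        by (auto simp: y_def \<Phi>_def)
      also have "\<dots> \<le> K * norm u * (C * \<Phi> z0)"
        using z0(2)[OF z'] d(2) \<open>C \<ge> 0\<close> by (intro mult_left_mono) auto
      finally show "norm (frechet_derivative (\<lambda>z. \<phi> i (y z)) (at z') u) \<le> K * C * \<Phi> z0 * norm u"
        by (simp add: mult_ac)
    qed
    have "norm (\<phi> i (y z) - \<phi> i (y (x p))) \<le> K * C * \<Phi> z0 * norm (z - x p)"
      using t by (intro differentiable_bound[OF convex_cball der on z]) auto
    also have "\<dots> \<le> K * C * \<Phi> z0 * t"
      using z d(2) \<open>C \<ge> 0\<close> \<Phi>0 by (intro mult_left_mono) (auto simp: dist_norm norm_minus_commute)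
    finally show ?thesis using p[OF i] by (simp add: yp)
  qed
  then have "(\<Sum>k\<in>I. \<bar>\<phi> k (y z0)\<bar>) \<le> (\<Sum>k\<in>I. K * C * \<Phi> z0 * t)"
    using z0(1) by (intro sum_mono) blast
  moreover have "\<Phi> z0 = (\<Sum>k\<in>I. \<bar>\<phi> k (y z0)\<bar>)" by (simp add: \<Phi>_def)
  ultimately have "\<Phi> z0 \<le> (\<Sum>k\<in>I. K * C * \<Phi> z0 * t)" by simp
  then have "\<Phi> z0 \<le> (L * t) * \<Phi> z0"
    by (simp add: L_def mult_ac)
  then have "\<Phi> z0 = 0"
    using Lt \<Phi>0[of z0] mult_strict_right_mono[OF Lt, of "\<Phi> z0"] by (cases "\<Phi> z0 = 0") auto
  then have zero: "\<phi> i (y z) = 0" if "i \<in> I" "z \<in> cball (x p) t" for i z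
  proof -
    have "\<Phi> z = 0" using z0(2)[OF that(2)] \<Phi>0[of z] \<open>\<Phi> z0 = 0\<close> by linarith
    then show ?thesis using I that(1) by (simp add: \<Phi>_def sum_nonneg_eq_0_iff)
  qed
  have "open (U \<inter> x -` ball (x p) t)"
    using chartD[OF U(1)] by (intro continuous_open_preimage) (auto simp: homeomorphism_def)
  moreover have "p \<in> U \<inter> x -` ball (x p) t" using U(2) t by simp
  moreover have "\<phi> i q = 0" if "q \<in> U \<inter> x -` ball (x p) t" "i \<in> I" for q i
    using zero[OF that(2), of "x q"] that(1) yx by simp
  ultimately show ?thesis by blast
qed

text \<open>The common zero set is closed by continuity, open by \<open>zero_set_open\<close>, and
  contains p.\<close>

lemma unique_continuation:
  fixes \<phi> :: "'i \<Rightarrow> 'm \<Rightarrow> real"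
  assumes con: "connected (UNIV :: 'm set)"
    and I: "finite I" and sm: "\<And>i. i \<in> I \<Longrightarrow> smooth_fun A (\<phi> i)"
    and bound: "\<And>i j p. i \<in> I \<Longrightarrow> \<bar>e j p (\<phi> i)\<bar> \<le> C * (\<Sum>k\<in>I. \<bar>\<phi> k p\<bar>)" and "C \<ge> 0"
    and p: "\<And>i. i \<in> I \<Longrightarrow> \<phi> i p = 0"
    and i: "i \<in> I"
  shows "\<phi> i q = 0"
proof -
  define Z where "Z = {q. \<forall>i\<in>I. \<phi> i q = 0}"
  have "open Z"
    unfolding open_subopen[of Z]
    using zero_set_open[OF I sm bound \<open>C \<ge> 0\<close>] by (fastforce simp: Z_def)
  moreover have "closed Z"
  proof -
    have "closed {q. \<phi> i q = 0}" if "i \<in> I" for i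
      using smooth_fun_continuous[OF sm[OF that]] by (intro closed_Collect_eq) auto
    moreover have "Z = (\<Inter>i\<in>I. {q. \<phi> i q = 0})" by (auto simp: Z_def)
    ultimately show ?thesis by (auto intro: closed_INT)
  qed
  moreover have "p \<in> Z" using p by (simp add: Z_def)
  ultimately have "Z = UNIV"
    using con connected_clopen[of "UNIV :: 'm set"] by auto
  then show ?thesis using i by (auto simp: Z_def)
qed

end

section \<open>Complex forms in a frame with Sasakian brackets\<close>

definition csmooth :: "'m chart set \<Rightarrow> ('m \<Rightarrow> complex) \<Rightarrow> bool" where
  "csmooth A f \<longleftrightarrow> smooth_fun A (\<lambda>p. Re (f p)) \<and> smooth_fun A (\<lambda>p. Im (f p))"

lemma csmooth_const: "csmooth A (\<lambda>p. c)"
  by (simp add: csmooth_def smooth_fun_const)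

lemma csmooth_of_real: "smooth_fun A f \<Longrightarrow> csmooth A (\<lambda>p. complex_of_real (f p))"
  by (simp add: csmooth_def smooth_fun_const)

context manifold3
begin

lemma csmooth_add: "csmooth A f \<Longrightarrow> csmooth A h \<Longrightarrow> csmooth A (\<lambda>p. f p + h p)"
  by (simp add: csmooth_def smooth_fun_add)

lemma csmooth_diff: "csmooth A f \<Longrightarrow> csmooth A h \<Longrightarrow> csmooth A (\<lambda>p. f p - h p)"
  by (simp add: csmooth_def smooth_fun_diff)

lemma csmooth_mult: "csmooth A f \<Longrightarrow> csmooth A h \<Longrightarrow> csmooth A (\<lambda>p. f p * h p)"
  by (simp add: csmooth_def smooth_fun_add smooth_fun_diff smooth_fun_mult)

lemma csmooth_cnj: "csmooth A f \<Longrightarrow> csmooth A (\<lambda>p. cnj (f p))"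
  by (simp add: csmooth_def smooth_fun_uminus)

lemmas csmooth_intros = csmooth_const csmooth_of_real csmooth_add csmooth_diff
  csmooth_mult csmooth_cnj

context
  fixes v p assumes v: "v \<in> tangent_space A p"
begin

lemma cderiv_const: "cderiv v (\<lambda>q. c) = 0"
  by (simp add: cderiv_def tangent_const[OF v] complex_eq_iff)

lemma cderiv_of_real: "cderiv v (\<lambda>q. complex_of_real (f q)) = complex_of_real (v f)"
  by (simp add: cderiv_def tangent_const[OF v] complex_eq_iff)

lemma cderiv_add:
  "csmooth A f \<Longrightarrow> csmooth A h \<Longrightarrow> cderiv v (\<lambda>q. f q + h q) = cderiv v f + cderiv v h"
  by (simp add: cderiv_def csmooth_def tangent_add[OF v] complex_eq_iff)

lemma cderiv_diff:
  "csmooth A f \<Longrightarrow> csmooth A h \<Longrightarrow> cderiv v (\<lambda>q. f q - h q) = cderiv v f - cderiv v h"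
  by (simp add: cderiv_def csmooth_def tangent_diff[OF v] complex_eq_iff)

lemma cderiv_mult:
  "csmooth A f \<Longrightarrow> csmooth A h \<Longrightarrow> cderiv v (\<lambda>q. f q * h q) = f p * cderiv v h + cderiv v f * h p"
  by (simp add: cderiv_def csmooth_def tangent_diff[OF v] tangent_add[OF v] tangent_mult[OF v]
      smooth_fun_mult complex_eq_iff)

lemma cderiv_cnj: "csmooth A f \<Longrightarrow> cderiv v (\<lambda>q. cnj (f q)) = cnj (cderiv v f)"
  by (simp add: cderiv_def csmooth_def tangent_uminus[OF v] complex_eq_iff)

lemmas cderiv_rules = cderiv_const cderiv_of_real cderiv_add cderiv_diff
  cderiv_mult cderiv_cnj

end

end

section \<open>Forms given by their components in the coframe\<close>

context framed
begin

lemma cderiv_decomp: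
  assumes "v \<in> tangent_space A p"
  shows "cderiv v f = (\<Sum>j\<in>UNIV. complex_of_real (coframe e j p v) * cderiv (e j p) f)"
  by (simp add: cderiv_def complex_eq_iff
      tangent_decomp[OF assms, of "\<lambda>q. Re (f q)"] tangent_decomp[OF assms, of "\<lambda>q. Im (f q)"])

definition one_form_of :: "(3 \<Rightarrow> 'm \<Rightarrow> complex) \<Rightarrow> 'm cform1" where
  "one_form_of a X p = (\<Sum>j\<in>UNIV. a j p * complex_of_real (coframe e j p (X p)))"

text \<open>\<open>two_form_of b\<close> is \<open>b\<^sub>1 \<omega>\<^sup>2 \<and> \<omega>\<^sup>3 + b\<^sub>2 \<omega>\<^sup>3 \<and> \<omega>\<^sup>1 + b\<^sub>3 \<omega>\<^sup>1 \<and> \<omega>\<^sup>2\<close>.\<close>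

definition two_form_of :: "(3 \<Rightarrow> 'm \<Rightarrow> complex) \<Rightarrow> 'm cform2" where
  "two_form_of b X Y p = (let x = \<lambda>j. complex_of_real (coframe e j p (X p));
                              y = \<lambda>j. complex_of_real (coframe e j p (Y p))
    in b 1 p * (x 2 * y 3 - x 3 * y 2) + b 2 p * (x 3 * y 1 - x 1 * y 3)
       + b 3 p * (x 1 * y 2 - x 2 * y 1))"

lemma one_form_of_frame: "one_form_of a (e k) = a k"
  by (rule ext) (simp add: one_form_of_def coframe_frame if_distrib cong: if_cong)

lemma two_form_of_frame:
  "two_form_of b (e 2) (e 3) = b 1" "two_form_of b (e 3) (e 2) = (\<lambda>p. - b 1 p)"
  "two_form_of b (e 3) (e 1) = b 2" "two_form_of b (e 1) (e 3) = (\<lambda>p. - b 2 p)"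
  "two_form_of b (e 1) (e 2) = b 3" "two_form_of b (e 2) (e 1) = (\<lambda>p. - b 3 p)"
  by (rule ext; simp add: two_form_of_def coframe_frame)+

lemma one_form_of_eq_iff:
  fixes a b :: "3 \<Rightarrow> 'm \<Rightarrow> complex"
  shows "(\<forall>X\<in>vfields A. \<forall>p. one_form_of a X p = one_form_of b X p) \<longleftrightarrow> (\<forall>j p. a j p = b j p)"
proof
  assume L: "\<forall>X\<in>vfields A. \<forall>p. one_form_of a X p = one_form_of b X p"
  show "\<forall>j p. a j p = b j p"
    using bspec[OF L frame_vfield] by (simp add: one_form_of_frame)
qed (simp add: one_form_of_def)

text \<open>The form \<beta> need not be antisymmetric, hence the halved differences. Raising the
  index 1 contributes the sign in the second and third components; the first involves only the
  indices 2 and 3.\<close>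

lemma hodge2_eq:
  "hodge2 r e \<beta> = one_form_of (\<lambda>j p.
     if j = 1 then (\<beta> (e 2) (e 3) p - \<beta> (e 3) (e 2) p) / 2
     else if j = 2 then (-1)^r * (\<beta> (e 3) (e 1) p - \<beta> (e 1) (e 3) p) / 2
     else (-1)^r * (\<beta> (e 1) (e 2) p - \<beta> (e 2) (e 1) p) / 2)"
  by (intro ext) (simp add: hodge2_def one_form_of_def volume_form_def sum_3 det_3
      coframe_frame sig_def field_simps)

end

text \<open>The structure constants are those of a Sasakian frame, with \<open>\<kappa> = (H + 3 (-1)\<^sup>r) / 2\<close>.\<close>

locale sasakian_brackets = framed A e
  for A :: "'m::{t2_space,second_countable_topology} chart set" and e +
  fixes \<kappa> :: real
  assumes coframe_smooth: "X \<in> vfields A \<Longrightarrow> smooth_fun A (\<lambda>p. coframe e j p (X p))"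
    and bracket12: "lie_bracket (e 1) (e 2) = (\<lambda>p f. - \<kappa> * e 3 p f)"
    and bracket13: "lie_bracket (e 1) (e 3) = (\<lambda>p f. \<kappa> * e 2 p f)"
    and bracket23: "lie_bracket (e 2) (e 3) = (\<lambda>p f. - 2 * e 1 p f)"
begin

text \<open>The structure equations of the coframe, solved for the bracket: d\<omega>1 = 2 \<omega>2
  \<and> \<omega>3, d\<omega>2 = \<kappa> \<omega>3 \<and> \<omega>1, d\<omega>3 = \<kappa>
  \<omega>1 \<and> \<omega>2. Second derivatives of f along the frame cancel up to the frame
  brackets.\<close>

lemma coframe_bracket:
  assumes X: "X \<in> vfields A" and Y: "Y \<in> vfields A"
  defines "x \<equiv> \<lambda>j p. coframe e j p (X p)" and "y \<equiv> \<lambda>j p. coframe e j p (Y p)"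
  shows "coframe e 1 p (lie_bracket X Y p)
      = X p (y 1) - Y p (x 1) - 2 * (x 2 p * y 3 p - x 3 p * y 2 p)"
    "coframe e 2 p (lie_bracket X Y p)
      = X p (y 2) - Y p (x 2) + \<kappa> * (x 1 p * y 3 p - x 3 p * y 1 p)"
    "coframe e 3 p (lie_bracket X Y p)
      = X p (y 3) - Y p (x 3) - \<kappa> * (x 1 p * y 2 p - x 2 p * y 1 p)"
proof -
  define c where "c = (\<lambda>j::3. X p (y j) - Y p (x j) +
    (if j = 1 then - 2 * (x 2 p * y 3 p - x 3 p * y 2 p)
     else if j = 2 then \<kappa> * (x 1 p * y 3 p - x 3 p * y 1 p)
     else - \<kappa> * (x 1 p * y 2 p - x 2 p * y 1 p)))"
  have XT: "X q \<in> tangent_space A q" and YT: "Y q \<in> tangent_space A q" for q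
    using X Y by (simp_all add: vfields_def)
  have Xf: "X q f = (\<Sum>j\<in>UNIV. x j q * e j q f)" and Yf: "Y q f = (\<Sum>j\<in>UNIV. y j q * e j q f)" for q f
    unfolding x_def y_def by (rule tangent_decomp[OF XT] tangent_decomp[OF YT])+
  have xs: "smooth_fun A (x j)" and ys: "smooth_fun A (y j)" for j
    unfolding x_def y_def by (intro coframe_smooth X Y)+
  have "lie_bracket X Y p f = (\<Sum>j\<in>UNIV. c j * e j p f)" for f
  proof (cases "smooth_fun A f")
    case True
    define d where "d = (\<lambda>j k. e j p (\<lambda>q. e k q f))"
    have "X p (\<lambda>q. Y q f) = (\<Sum>k\<in>UNIV. y k p * X p (\<lambda>q. e k q f) + X p (y k) * e k p f)"
      unfolding Yf using True
      by (simp add: tangent_sum[OF XT] tangent_mult[OF XT] smooth_fun_mult ys frame_smooth)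
    then have 1: "X p (\<lambda>q. Y q f) = (\<Sum>k\<in>UNIV. y k p * (\<Sum>j\<in>UNIV. x j p * d j k) + X p (y k) * e k p f)"
      unfolding d_def Xf[of p "\<lambda>q. e _ q f"] .
    have "Y p (\<lambda>q. X q f) = (\<Sum>k\<in>UNIV. x k p * Y p (\<lambda>q. e k q f) + Y p (x k) * e k p f)"
      unfolding Xf using True
      by (simp add: tangent_sum[OF YT] tangent_mult[OF YT] smooth_fun_mult xs frame_smooth)
    then have 2: "Y p (\<lambda>q. X q f) = (\<Sum>k\<in>UNIV. x k p * (\<Sum>j\<in>UNIV. y j p * d j k) + Y p (x k) * e k p f)"
      unfolding d_def Yf[of p "\<lambda>q. e _ q f"] .
    have 3: "d 1 2 = d 2 1 - \<kappa> * e 3 p f" "d 1 3 = d 3 1 + \<kappa> * e 2 p f" "d 2 3 = d 3 2 - 2 * e 1 p f"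
      using fun_cong[OF fun_cong[OF bracket12, of p], of f] fun_cong[OF fun_cong[OF bracket13, of p], of f]
        fun_cong[OF fun_cong[OF bracket23, of p], of f]
      by (simp_all add: lie_bracket_def d_def)
    show ?thesis
      unfolding lie_bracket_def 1 2 by (simp add: sum_3 c_def 3 algebra_simps)
  next
    case False
    \<comment> \<open>On a non-smooth f both inner functions are identically 0, and tangent vectors
      annihilate constants.\<close>
    then show ?thesis
      by (simp add: lie_bracket_def tangent_nonsmooth[OF XT] tangent_nonsmooth[OF YT]
          tangent_nonsmooth[OF frame_tangent] tangent_const[OF XT] tangent_const[OF YT])
  qed
  then have "coframe e j p (lie_bracket X Y p) = c j" for j
    by (rule coframe_eqI)
  then show "coframe e 1 p (lie_bracket X Y p)
      = X p (y 1) - Y p (x 1) - 2 * (x 2 p * y 3 p - x 3 p * y 2 p)"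
    "coframe e 2 p (lie_bracket X Y p)
      = X p (y 2) - Y p (x 2) + \<kappa> * (x 1 p * y 3 p - x 3 p * y 1 p)"
    "coframe e 3 p (lie_bracket X Y p)
      = X p (y 3) - Y p (x 3) - \<kappa> * (x 1 p * y 2 p - x 2 p * y 1 p)"
    by (simp_all add: c_def)
qed

lemma coframe_const: "(\<lambda>q. coframe e j q (e k q)) = (\<lambda>q. if j = k then 1 else 0)"
  by (simp add: coframe_frame)

lemma ext_d1_frame:
  fixes a :: "3 \<Rightarrow> 'm \<Rightarrow> complex"
  shows
  "ext_d1 (one_form_of a) (e 2) (e 3) p = cderiv (e 2 p) (a 3) - cderiv (e 3 p) (a 2) + 2 * a 1 p"
  "ext_d1 (one_form_of a) (e 3) (e 2) p = cderiv (e 3 p) (a 2) - cderiv (e 2 p) (a 3) - 2 * a 1 p"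
  "ext_d1 (one_form_of a) (e 3) (e 1) p = cderiv (e 3 p) (a 1) - cderiv (e 1 p) (a 3) + \<kappa> * a 2 p"
  "ext_d1 (one_form_of a) (e 1) (e 3) p = cderiv (e 1 p) (a 3) - cderiv (e 3 p) (a 1) - \<kappa> * a 2 p"
  "ext_d1 (one_form_of a) (e 1) (e 2) p = cderiv (e 1 p) (a 2) - cderiv (e 2 p) (a 1) + \<kappa> * a 3 p"
  "ext_d1 (one_form_of a) (e 2) (e 1) p = cderiv (e 2 p) (a 1) - cderiv (e 1 p) (a 2) - \<kappa> * a 3 p"
  unfolding ext_d1_def one_form_of_frame
  by (simp_all add: one_form_of_def sum_3 coframe_bracket[OF frame_vfield frame_vfield]
      coframe_const coframe_frame tangent_const[OF frame_tangent])

text \<open>By the structure equations each d\<omega>j is a multiple of the product of the other two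
  coframe elements, so all \<omega>j \<and> \<omega>k are closed and only the derivatives of the
  coefficients survive. For general X, Y, Z the derivatives of the coframe components cancel against
  those in the bracket terms.\<close>

lemma ext_d2_two_form_of:
  assumes b: "\<And>j. csmooth A (b j)"
    and X: "X \<in> vfields A" and Y: "Y \<in> vfields A" and Z: "Z \<in> vfields A"
  shows "ext_d2 (two_form_of b) X Y Z p
    = complex_of_real (volume_form e X Y Z p) * (\<Sum>j\<in>UNIV. cderiv (e j p) (b j))"
proof -
  have T: "X p \<in> tangent_space A p" "Y p \<in> tangent_space A p" "Z p \<in> tangent_space A p"
    using X Y Z by (simp_all add: vfields_def)
  have d: "cderiv v (two_form_of b Y Z) =
      b 1 p * (coframe e 2 p (Y p) * v (\<lambda>q. coframe e 3 q (Z q)) + v (\<lambda>q. coframe e 2 q (Y q)) * coframe e 3 p (Z p)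
             - coframe e 3 p (Y p) * v (\<lambda>q. coframe e 2 q (Z q)) - v (\<lambda>q. coframe e 3 q (Y q)) * coframe e 2 p (Z p))
    + b 2 p * (coframe e 3 p (Y p) * v (\<lambda>q. coframe e 1 q (Z q)) + v (\<lambda>q. coframe e 3 q (Y q)) * coframe e 1 p (Z p)
             - coframe e 1 p (Y p) * v (\<lambda>q. coframe e 3 q (Z q)) - v (\<lambda>q. coframe e 1 q (Y q)) * coframe e 3 p (Z p))
    + b 3 p * (coframe e 1 p (Y p) * v (\<lambda>q. coframe e 2 q (Z q)) + v (\<lambda>q. coframe e 1 q (Y q)) * coframe e 2 p (Z p)
             - coframe e 2 p (Y p) * v (\<lambda>q. coframe e 1 q (Z q)) - v (\<lambda>q. coframe e 2 q (Y q)) * coframe e 1 p (Z p))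
    + (\<Sum>j\<in>UNIV. coframe e j p v * cderiv (e j p) (b 1)) * (coframe e 2 p (Y p) * coframe e 3 p (Z p) - coframe e 3 p (Y p) * coframe e 2 p (Z p))
    + (\<Sum>j\<in>UNIV. coframe e j p v * cderiv (e j p) (b 2)) * (coframe e 3 p (Y p) * coframe e 1 p (Z p) - coframe e 1 p (Y p) * coframe e 3 p (Z p))
    + (\<Sum>j\<in>UNIV. coframe e j p v * cderiv (e j p) (b 3)) * (coframe e 1 p (Y p) * coframe e 2 p (Z p) - coframe e 2 p (Y p) * coframe e 1 p (Z p))"
    if v: "v \<in> tangent_space A p" and Y: "Y \<in> vfields A" and Z: "Z \<in> vfields A" for v Y Z
  proof -
    have s: "csmooth A (\<lambda>q. complex_of_real (coframe e j q (Y q)))"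
      "csmooth A (\<lambda>q. complex_of_real (coframe e j q (Z q)))" for j
      using coframe_smooth Y Z by (simp_all add: csmooth_of_real)
    show ?thesis
      unfolding two_form_of_def Let_def cderiv_decomp[OF v, of "b _", symmetric]
      by (simp add: cderiv_rules[OF v] csmooth_intros b s) (simp add: algebra_simps)
  qed
  show ?thesis
    unfolding ext_d2_def d[OF T(1) Y Z] d[OF T(2) X Z] d[OF T(3) X Y]
    by (simp add: two_form_of_def coframe_bracket X Y Z volume_form_def det_3 sum_3 of_real_diff)
      (simp add: algebra_simps)
qed

lemma closed2_two_form_of:
  assumes b: "\<And>j. csmooth A (b j)"
  shows "closed2 A (two_form_of b) \<longleftrightarrow> (\<forall>p. (\<Sum>j\<in>UNIV. cderiv (e j p) (b j)) = 0)"
proof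
  assume L: "closed2 A (two_form_of b)"
  show "\<forall>p. (\<Sum>j\<in>UNIV. cderiv (e j p) (b j)) = 0"
  proof
    fix p
    have "volume_form e (e 1) (e 2) (e 3) p = 1"
      by (simp add: volume_form_def det_3 coframe_frame)
    moreover have "ext_d2 (two_form_of b) (e 1) (e 2) (e 3) p = 0"
      using L frame_vfield by (simp add: closed2_def)
    ultimately show "(\<Sum>j\<in>UNIV. cderiv (e j p) (b j)) = 0"
      by (simp add: ext_d2_two_form_of[OF b frame_vfield frame_vfield frame_vfield])
  qed
qed (simp add: closed2_def ext_d2_two_form_of[OF b])

end

section \<open>Sasakian space-forms\<close>

context manifold3
begin

text \<open>Tangent vectors may be given in different charts, and adding them requires a common one.
  The chain rule with the transition map transports the direction; smooth overlaps make that map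
  differentiable at the point.\<close>

lemma tangent_in_chart:
  assumes v: "v \<in> tangent_space A p" and V: "(V, y) \<in> A" "p \<in> V"
  obtains u where "\<And>f. v f = (if smooth_fun A f
    then frechet_derivative (\<lambda>z. f (inv_into V y z)) (at (y p)) u else 0)"
proof -
  obtain U x u where U: "(U, x) \<in> A" "p \<in> U"
    and vf: "\<And>f. v f = (if smooth_fun A f
            then frechet_derivative (\<lambda>z. f (inv_into U x z)) (at (x p)) u else 0)"
    using v by (auto simp: tangent_space_def)
  define \<tau> where "\<tau> = (\<lambda>z. y (inv_into U x z))"
  note hU = chartD(3)[OF U(1)] and hV = chartD(3)[OF V(1)]
  have xp: "inv_into U x (x p) = p" using hU U(2) by (simp add: homeomorphism_def)
  have "openin (top_of_set (x ` U)) (x ` (U \<inter> V))"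
    using homeomorphism_imp_open_map[OF hU] chartD(1)[OF V(1)]
    by (metis openin_open_Int)
  then have op: "open (x ` (U \<inter> V))"
    using chartD(2)[OF U(1)] openin_open_trans by blast
  have mem: "x p \<in> x ` (U \<inter> V)" using U(2) V(2) by blast
  have "smooth_on (x ` (U \<inter> V)) \<tau>"
    using atlas U(1) V(1) unfolding smooth_atlas_def \<tau>_def by fastforce
  then have \<tau>: "\<tau> differentiable (at (x p))"
    using smooth_onD(1) mem by blast
  have "v f = (if smooth_fun A f then frechet_derivative (\<lambda>z. f (inv_into V y z)) (at (y p))
      (frechet_derivative \<tau> (at (x p)) u) else 0)" for f
  proof (cases "smooth_fun A f")
    case True
    have fy: "(\<lambda>z. f (inv_into V y z)) differentiable (at (\<tau> (x p)))"
      using smooth_onD(1)[OF smooth_funD[OF True V(1)]] V(2) by (simp add: \<tau>_def xp)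
    have "f (inv_into U x z) = ((\<lambda>z. f (inv_into V y z)) \<circ> \<tau>) z" if "z \<in> x ` (U \<inter> V)" for z
      using that hU hV by (auto simp: \<tau>_def homeomorphism_def)
    then have "frechet_derivative (\<lambda>z. f (inv_into U x z)) (at (x p))
        = frechet_derivative ((\<lambda>z. f (inv_into V y z)) \<circ> \<tau>) (at (x p))"
      by (rule frechet_derivative_cong_open[OF op mem])
    also have "\<dots> = frechet_derivative (\<lambda>z. f (inv_into V y z)) (at (\<tau> (x p)))
        \<circ> frechet_derivative \<tau> (at (x p))"
      by (rule frechet_derivative_compose[OF \<tau> fy])
    finally show ?thesis using True by (simp add: vf \<tau>_def xp)
  qed (simp add: vf)
  then show thesis by (rule that)
qed

lemma tangent_space_lin:
  assumes "u \<in> tangent_space A p" "v \<in> tangent_space A p"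
  shows "(\<lambda>f. a * u f + v f) \<in> tangent_space A p"
proof -
  obtain V y where V: "(V, y) \<in> A" "p \<in> V" using chart_exists by blast
  obtain u' where u': "\<And>f. u f = (if smooth_fun A f
    then frechet_derivative (\<lambda>z. f (inv_into V y z)) (at (y p)) u' else 0)"
    using tangent_in_chart[OF assms(1) V] by blast
  obtain v' where v': "\<And>f. v f = (if smooth_fun A f
    then frechet_derivative (\<lambda>z. f (inv_into V y z)) (at (y p)) v' else 0)"
    using tangent_in_chart[OF assms(2) V] by blast
  have "a * u f + v f = (if smooth_fun A f
    then frechet_derivative (\<lambda>z. f (inv_into V y z)) (at (y p)) (a *\<^sub>R u' + v') else 0)" for f
  proof (cases "smooth_fun A f")
    case True
    have "(\<lambda>z. f (inv_into V y z)) differentiable (at (y p))"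
      using smooth_onD(1)[OF smooth_funD[OF True V(1)]] V(2) by blast
    then have "linear (frechet_derivative (\<lambda>z. f (inv_into V y z)) (at (y p)))"
      by (rule linear_frechet_derivative)
    then show ?thesis using True by (simp add: u' v' linear_add linear_cmul)
  qed (simp add: u' v')
  then show ?thesis
    unfolding tangent_space_def using V by blast
qed

lemma tangent_space_zero: "v \<in> tangent_space A p \<Longrightarrow> (\<lambda>f. 0) \<in> tangent_space A p"
  using tangent_space_lin[of v p v "-1"] by simp

end

text \<open>Linearity of L is available only on tangent vectors and in the shape
  \<open>a * u + v\<close>, so v is assembled from the zero vector by adding one frame vector at a
  time.\<close>

lemma (in framed) frame_expansion_linear:
  fixes L :: "'m tvec \<Rightarrow> real"
  assumes lin: "\<And>u v a. u \<in> tangent_space A p \<Longrightarrow> v \<in> tangent_space A p \<Longrightarrow>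
      L (\<lambda>f. a * u f + v f) = a * L u + L v"
    and v: "v \<in> tangent_space A p"
  shows "L v = (\<Sum>j\<in>UNIV. coframe e j p v * L (e j p))"
proof -
  note z = tangent_space_zero[OF v] and E = frame_tangent[of _ p]
  have "L (\<lambda>f. 0) = 0"
    using lin[OF v v, of "-1"] by simp
  moreover define c where "c = (\<lambda>j. coframe e j p v)"
  define v3 where "v3 = (\<lambda>f. c 3 * e 3 p f + 0)"
  define v2 where "v2 = (\<lambda>f. c 2 * e 2 p f + v3 f)"
  have T: "v3 \<in> tangent_space A p" "v2 \<in> tangent_space A p"
    unfolding v3_def v2_def by (intro tangent_space_lin E z)+
  have "v = (\<lambda>f. c 1 * e 1 p f + v2 f)"
    using tangent_decomp[OF v] by (simp add: sum_3 fun_eq_iff c_def v2_def v3_def)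
  then have "L v = c 1 * L (e 1 p) + L v2"
    using lin[OF E T(2)] by simp
  moreover have "L v2 = c 2 * L (e 2 p) + L v3"
    unfolding v2_def by (rule lin[OF E T(1)])
  moreover have "L v3 = c 3 * L (e 3 p) + L (\<lambda>f. 0)"
    unfolding v3_def by (rule lin[OF E z])
  ultimately show ?thesis
    by (simp add: sum_3 c_def)
qed

text \<open>The identity \<open>\<phi> \<xi> = 0\<close> follows from \<open>\<phi>\<^sup>2 = - id + \<eta> \<otimes> \<xi>\<close>; then
  \<open>g (\<phi> u) (\<phi> \<xi>) = g u \<xi> - \<eta> u\<close> gives the claim.\<close>

lemma (in manifold3) contact_metric_eta:
  assumes "contact_metric A \<phi> \<xi> \<eta> g" and u: "u \<in> tangent_space A p"
  shows "g p u (\<xi> p) = \<eta> p u"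
proof -
  have g: "\<And>u v w a. u \<in> tangent_space A p \<Longrightarrow> v \<in> tangent_space A p \<Longrightarrow> w \<in> tangent_space A p \<Longrightarrow>
      g p (\<lambda>f. a * u f + v f) w = a * g p u w + g p v w"
    and sym: "\<And>u v. u \<in> tangent_space A p \<Longrightarrow> v \<in> tangent_space A p \<Longrightarrow> g p u v = g p v u"
    and \<phi>: "\<And>u v a. u \<in> tangent_space A p \<Longrightarrow> v \<in> tangent_space A p \<Longrightarrow>
      \<phi> p (\<lambda>f. a * u f + v f) = (\<lambda>f. a * \<phi> p u f + \<phi> p v f)"
    and \<phi>T: "\<And>u. u \<in> tangent_space A p \<Longrightarrow> \<phi> p u \<in> tangent_space A p"
    and \<xi>: "\<xi> p \<in> tangent_space A p" and \<eta>\<xi>: "\<eta> p (\<xi> p) = 1"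
    and \<phi>\<phi>: "\<And>u. u \<in> tangent_space A p \<Longrightarrow> \<phi> p (\<phi> p u) = (\<lambda>f. - u f + \<eta> p u * \<xi> p f)"
    and g\<phi>: "\<And>u v. u \<in> tangent_space A p \<Longrightarrow> v \<in> tangent_space A p \<Longrightarrow>
      g p (\<phi> p u) (\<phi> p v) = g p u v - \<eta> p u * \<eta> p v"
    using assms(1) by (simp_all add: contact_metric_def riemannian_metric_def endo_field_def vfields_def)
  define w where "w = \<phi> p (\<xi> p)"
  define a where "a = \<eta> p w"
  have wT: "w \<in> tangent_space A p" unfolding w_def by (rule \<phi>T[OF \<xi>])
  have \<phi>0: "\<phi> p (\<lambda>f. 0) = (\<lambda>f. 0)"
    using \<phi>[OF \<xi> \<xi>, of "-1"] by simp
  have \<phi>w: "\<phi> p w = (\<lambda>f. 0)"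
    unfolding w_def \<phi>\<phi>[OF \<xi>] using \<eta>\<xi> by simp
  have w: "w f = a * \<xi> p f" for f
    using fun_cong[OF \<phi>\<phi>[OF wT], of f] unfolding \<phi>w \<phi>0 by (simp add: a_def)
  \<comment> \<open>The multiple a \<xi> is split to match the form in which linearity of \<phi> is
    given. Then \<phi> w = a w, and \<phi> w = 0 leaves a = 0 or w = 0; in both cases w = a \<xi>
    vanishes.\<close>
  have "w = (\<lambda>f. (a - 1) * \<xi> p f + \<xi> p f)"
    by (rule ext) (simp add: w left_diff_distrib)
  then have "\<phi> p w = (\<lambda>f. (a - 1) * w f + w f)"
    using \<phi>[OF \<xi> \<xi>, of "a - 1"] by (simp add: w_def)
  then have "a * w f = 0" for f
    using \<phi>w by (auto simp: fun_eq_iff left_diff_distrib)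
  then have w0: "w = (\<lambda>f. 0)"
    using w by (cases "a = 0") auto
  have "g p (\<lambda>f. 0) (\<phi> p u) = 0"
    using g[OF \<xi> \<xi> \<phi>T[OF u], of "-1"] by simp
  then have "g p (\<phi> p u) w = 0"
    using sym[OF \<phi>T[OF u] wT] by (simp add: w0)
  then show ?thesis
    using g\<phi>[OF u \<xi>] \<eta>\<xi> by (simp add: w_def)
qed

text \<open>In the Lorentzian case the correction by \<eta> \<otimes> \<eta> inherits bilinearity,
  symmetry and smoothness from \<eta>, and turns g'(u, \<xi>) = \<eta>(u) into g(u, \<xi>) =
  \<eta>(u) - 2 \<eta>(u) = - \<eta>(u).\<close>

lemma (in manifold3) pseudo_sasakian_metric:
  assumes "pseudo_sasakian A r \<phi> \<xi> \<eta> g"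
  shows "\<And>u v w a. u \<in> tangent_space A p \<Longrightarrow> v \<in> tangent_space A p \<Longrightarrow> w \<in> tangent_space A p \<Longrightarrow>
      g p (\<lambda>f. a * u f + v f) w = a * g p u w + g p v w"
    and "\<And>u v. u \<in> tangent_space A p \<Longrightarrow> v \<in> tangent_space A p \<Longrightarrow> g p u v = g p v u"
    and "\<And>X Y. X \<in> vfields A \<Longrightarrow> Y \<in> vfields A \<Longrightarrow> smooth_fun A (\<lambda>p. g p (X p) (Y p))"
    and "\<And>u. u \<in> tangent_space A p \<Longrightarrow> \<eta> p u = (-1)^r * g p u (\<xi> p)"
proof -
  obtain g' where c: "contact_metric A \<phi> \<xi> \<eta> g'"
    and g: "r = 0 \<and> g = g' \<or> r = 1 \<and> g = (\<lambda>p u v. g' p u v - 2 * \<eta> p u * \<eta> p v)"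
    using assms by (auto simp: pseudo_sasakian_def sasakian_def)
  have \<eta>: "\<And>u v a. u \<in> tangent_space A p \<Longrightarrow> v \<in> tangent_space A p \<Longrightarrow>
      \<eta> p (\<lambda>f. a * u f + v f) = a * \<eta> p u + \<eta> p v"
    and \<eta>s: "\<And>X. X \<in> vfields A \<Longrightarrow> smooth_fun A (\<lambda>p. \<eta> p (X p))"
    and \<eta>\<xi>: "\<eta> p (\<xi> p) = 1"
    using c by (simp_all add: contact_metric_def one_form_def)
  have g': "\<And>u v w a. u \<in> tangent_space A p \<Longrightarrow> v \<in> tangent_space A p \<Longrightarrow> w \<in> tangent_space A p \<Longrightarrow>
      g' p (\<lambda>f. a * u f + v f) w = a * g' p u w + g' p v w"
    and sym: "\<And>u v. u \<in> tangent_space A p \<Longrightarrow> v \<in> tangent_space A p \<Longrightarrow> g' p u v = g' p v u"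
    and sm: "\<And>X Y. X \<in> vfields A \<Longrightarrow> Y \<in> vfields A \<Longrightarrow> smooth_fun A (\<lambda>p. g' p (X p) (Y p))"
    using c by (simp_all add: contact_metric_def riemannian_metric_def)
  show "g p (\<lambda>f. a * u f + v f) w = a * g p u w + g p v w"
    if "u \<in> tangent_space A p" "v \<in> tangent_space A p" "w \<in> tangent_space A p" for u v w a
    using g g'[OF that] \<eta>[OF that(1,2)] by (auto simp: algebra_simps)
  show "g p u v = g p v u" if "u \<in> tangent_space A p" "v \<in> tangent_space A p" for u v
    using g sym[OF that] by auto
  show "smooth_fun A (\<lambda>p. g p (X p) (Y p))" if "X \<in> vfields A" "Y \<in> vfields A" for X Y
    using g by (elim disjE conjE; simp)
      (intro sm \<eta>s that smooth_fun_diff smooth_fun_mult smooth_fun_const)+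
  show "\<eta> p u = (-1)^r * g p u (\<xi> p)" if "u \<in> tangent_space A p" for u
    using g contact_metric_eta[OF c that] \<eta>\<xi> by auto
qed

section \<open>The space-form together with a Sasakian frame\<close>

locale sasakian_framed = manifold3 A for A :: "'m::{t2_space,second_countable_topology} chart set" +
  fixes r :: nat and H :: real
    and \<phi> :: "'m endo" and \<xi> :: "'m vfield" and \<eta> :: "'m cotensor1" and g :: "'m cotensor2"
    and e :: "3 \<Rightarrow> 'm vfield"
  assumes r01: "r \<in> {0, 1}"
    and space_form: "sasakian_space_form A r \<phi> \<xi> \<eta> g H"
    and sframe: "sasakian_frame A r \<xi> g H e"
begin

definition \<epsilon> :: real where "\<epsilon> = (-1)^r"

definition \<kappa> :: real where "\<kappa> = (H + 3 * \<epsilon>) / 2"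

sublocale framed A e
  by unfold_locales (use sframe in \<open>simp add: sasakian_frame_def\<close>)

lemma pseudo: "pseudo_sasakian A r \<phi> \<xi> \<eta> g"
  using space_form by (simp add: sasakian_space_form_def)

text \<open>Simple connectedness makes any two loops freely homotopic. For constant loops at a and b
  the track of the base point under such a homotopy is a path from a to b.\<close>

lemma connected_manifold: "connected (UNIV :: 'm set)"
proof -
  have "path_component UNIV a b" for a b :: 'm
  proof -
    have "simply_connected (UNIV :: 'm set)"
      using space_form by (simp add: sasakian_space_form_def)
    then have "homotopic_loops UNIV (\<lambda>_. a) (\<lambda>_. b)"
      by (simp add: simply_connected_def path_def pathfinish_def pathstart_def)
    then show ?thesis
      using homotopic_loops_imp_path_component_value[of UNIV "\<lambda>_. a" "\<lambda>_. b" 0] by simp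
  qed
  then show ?thesis
    by (intro path_connected_imp_connected) (simp add: path_connected_component)
qed

lemma metric_frame:
  assumes "v \<in> tangent_space A p"
  shows "g p (e j p) v = sig r j * coframe e j p v"
proof -
  have "g p v (e j p) = (\<Sum>k\<in>UNIV. coframe e k p v * g p (e k p) (e j p))"
    by (rule frame_expansion_linear[of p "\<lambda>v. g p v (e j p)"])
      (use pseudo_sasakian_metric(1)[OF pseudo] frame_tangent assms in auto)
  also have "\<dots> = sig r j * coframe e j p v"
  proof -
    have "g p (e k p) (e j p) = (if k = j then sig r k else 0)" for k
      using sframe unfolding sasakian_frame_def by blast
    then show ?thesis by (simp only:) (simp add: if_distrib cong: if_cong)
  qed
  finally show ?thesis
    using pseudo_sasakian_metric(2)[OF pseudo frame_tangent assms] by simp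
qed

lemma eta_eq_coframe:
  assumes "v \<in> tangent_space A p"
  shows "\<eta> p v = coframe e 1 p v"
proof -
  have "e 1 = \<xi>" using sframe by (simp add: sasakian_frame_def)
  then have "\<eta> p v = (-1)^r * g p (e 1 p) v"
    using pseudo_sasakian_metric(2,4)[OF pseudo] frame_tangent assms by metis
  then show ?thesis
    using r01 by (auto simp: metric_frame[OF assms] sig_def)
qed

sublocale sasakian_brackets A e \<kappa>
proof unfold_locales
  fix X assume X: "X \<in> vfields A"
  then have T: "X p \<in> tangent_space A p" for p by (simp add: vfields_def)
  show "smooth_fun A (\<lambda>p. coframe e j p (X p))" for j
  proof -
    \<comment> \<open>The metric carries smoothness over to the coframe, which by itself is defined
      only pointwise through \<open>THE\<close>; the sign is its own inverse.\<close>
    have "coframe e j p (X p) = sig r j * g p (e j p) (X p)" for p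
      using r01 by (auto simp: metric_frame[OF T] sig_def)
    then show ?thesis
      using pseudo_sasakian_metric(3)[OF pseudo frame_vfield X]
      by (simp add: smooth_fun_mult smooth_fun_const)
  qed
qed (use sframe in \<open>unfold sasakian_frame_def \<kappa>_def \<epsilon>_def mult.commute[of "3::real"], blast+\<close>)

end

section \<open>Bilinears of quasi-Killing spinors\<close>

text \<open>The invariant form \<open>spin_form\<close> written out in coordinates for both
  signatures.\<close>

definition spin_scalar :: "nat \<Rightarrow> complex^2 \<Rightarrow> complex^2 \<Rightarrow> complex" where
  "spin_scalar r s t = (if r = 0 then cnj (s $ 1) * t $ 1 + cnj (s $ 2) * t $ 2
                        else cnj (s $ 1) * t $ 2 + cnj (s $ 2) * t $ 1)"

text \<open>Up to a sign these are the components of the current \<open>J\<close>; they also are half the components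
  of \<open>F\<close> with respect to \<open>\<omega>\<^sup>2 \<and> \<omega>\<^sup>3\<close>, \<open>\<omega>\<^sup>3 \<and> \<omega>\<^sup>1\<close>, \<open>\<omega>\<^sup>1 \<and> \<omega>\<^sup>2\<close>.\<close>

definition spin_current :: "nat \<Rightarrow> 3 \<Rightarrow> complex^2 \<Rightarrow> complex^2 \<Rightarrow> complex" where
  "spin_current r j s t =
     (if r = 0 then
        (if j = 1 then cnj (s $ 1) * t $ 2 + cnj (s $ 2) * t $ 1
         else if j = 2 then \<i> * (cnj (s $ 2) * t $ 1 - cnj (s $ 1) * t $ 2)
         else cnj (s $ 1) * t $ 1 - cnj (s $ 2) * t $ 2)
      else
        (if j = 1 then cnj (s $ 1) * t $ 1 + cnj (s $ 2) * t $ 2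
         else if j = 2 then cnj (s $ 1) * t $ 1 - cnj (s $ 2) * t $ 2
         else \<i> * (cnj (s $ 1) * t $ 2 - cnj (s $ 2) * t $ 1)))"

lemma gam_mult:
  "(gam 0 1 *v s) $ 1 = \<i> * s $ 2" "(gam 0 1 *v s) $ 2 = \<i> * s $ 1"
  "(gam (Suc 0) 1 *v s) $ 1 = s $ 2" "(gam (Suc 0) 1 *v s) $ 2 = s $ 1"
  "(gam r 2 *v s) $ 1 = s $ 2" "(gam r 2 *v s) $ 2 = - s $ 1"
  "(gam r 3 *v s) $ 1 = \<i> * s $ 1" "(gam r 3 *v s) $ 2 = - \<i> * s $ 2"
  by (simp_all add: gam_def pauli_def matrix_vector_mult_def sum_2 map_matrix_def)

lemma spin_form_simps:
  "spin_form 0 s t = cnj (s $ 1) * t $ 1 + cnj (s $ 2) * t $ 2"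
  "spin_form (Suc 0) s t = cnj (s $ 1) * t $ 2 + cnj (s $ 2) * t $ 1"
  by (simp_all add: spin_form_def sum_2 gam_mult)

lemma spin_form_gam1_eq_0_iff:
  assumes "r \<in> {0, 1}"
  shows "spin_form r s (gam r 1 *v t) = 0 \<longleftrightarrow> spin_current r 1 s t = 0"
proof -
  have "spin_form r s (gam r 1 *v t) = (if r = 0 then \<i> else 1) * spin_current r 1 s t"
    using assms by (auto simp: spin_form_simps gam_mult spin_current_def algebra_simps)
  then show ?thesis by simp
qed

lemma J_current_eq:
  assumes "r \<in> {0, 1}"
  shows "J_current r s t j p = - spin_current r j (s p) (t p)"
  using assms exhaust_3[of j]
  by (auto simp: J_current_def gam_up_def map_matrix_def matrix_vector_mult_def sig_def sum_2
      spin_form_simps gam_def pauli_def spin_current_def algebra_simps)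

text \<open>In dimension three the product of two distinct gamma matrices is a multiple of the
  third, so the components of F are again those of the current.\<close>

lemma spin_form_commutator:
  fixes s t :: "complex^2"
  assumes "r \<in> {0, 1}"
  defines "K \<equiv> \<lambda>j k. \<i> * spin_form r s ((gam r j ** gam r k - gam r k ** gam r j) *v t)"
  shows "K 2 3 = 2 * spin_current r 1 s t" "K 3 2 = - 2 * spin_current r 1 s t"
    and "K 3 1 = 2 * spin_current r 2 s t" "K 1 3 = - 2 * spin_current r 2 s t"
    and "K 1 2 = 2 * spin_current r 3 s t" "K 2 1 = - 2 * spin_current r 3 s t"
    and "K j j = 0"
proof -
  have "(gam r j ** gam r k - gam r k ** gam r j) *v t =
      gam r j *v (gam r k *v t) - gam r k *v (gam r j *v t)" for j k
    by (simp add: matrix_vector_mult_diff_rdistrib matrix_vector_mul_assoc)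
  then have K: "K j k = \<i> * spin_form r s (gam r j *v (gam r k *v t) - gam r k *v (gam r j *v t))" for j k
    by (simp only: K_def)
  show "K 2 3 = 2 * spin_current r 1 s t" "K 3 2 = - 2 * spin_current r 1 s t"
    "K 3 1 = 2 * spin_current r 2 s t" "K 1 3 = - 2 * spin_current r 2 s t"
    "K 1 2 = 2 * spin_current r 3 s t" "K 2 1 = - 2 * spin_current r 3 s t"
    "K j j = 0"
    unfolding K using assms(1)
    by (auto simp: spin_form_simps gam_mult spin_current_def algebra_simps)
qed

lemma (in framed) F_form_eq:
  assumes "r \<in> {0, 1}"
  shows "F_form r e s t = two_form_of (\<lambda>j p. 2 * spin_current r j (s p) (t p))"
  by (intro ext, unfold F_form_def two_form_of_def Let_def sum_3 spin_form_commutator[OF assms])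
    (simp add: field_simps)

text \<open>The components pair the matrix t s\<dagger>, of rank at most one, with three of the
  matrices 1, \<sigma>1, \<sigma>2, \<sigma>3. If they vanish, it is a multiple of the remaining one
  (1 for r = 0, \<sigma>1 for r = 1), which is invertible; hence it is zero.\<close>

lemma spin_current_nonzero:
  assumes "r \<in> {0, 1}" "\<And>j. spin_current r j s t = 0"
  shows "s = 0 \<or> t = 0"
  using assms(1) assms(2)[of 1] assms(2)[of 2] assms(2)[of 3]
  by (auto simp: spin_current_def vec_eq_iff forall_2)

text \<open>The same rank argument with the scalar in place of the first component: the remaining
  matrix is \<sigma>1 for r = 0 and 1 for r = 1.\<close>

lemma spin_scalar_current_nonzero:
  assumes "r \<in> {0, 1}" "spin_scalar r s t = 0" "spin_current r 2 s t = 0" "spin_current r 3 s t = 0"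
  shows "s = 0 \<or> t = 0"
  using assms
  by (auto simp: spin_current_def spin_scalar_def vec_eq_iff forall_2)

text \<open>Changing the signature only interchanges these two components up to sign, so their joint
  vanishing is the same condition in both.\<close>

lemma spin_current_23_eq_0_iff:
  assumes "r \<in> {0, 1}"
  shows "spin_current r 2 s t = 0 \<and> spin_current r 3 s t = 0 \<longleftrightarrow>
    cnj (s $ 2) * t $ 1 = cnj (s $ 1) * t $ 2 \<and> cnj (s $ 1) * t $ 1 = cnj (s $ 2) * t $ 2"
  using assms by (auto simp: spin_current_def)

section \<open>The quasi-Killing equation and its bilinears along the frame\<close>

context sasakian_framed
begin

definition frame_sqk :: "real \<Rightarrow> real \<Rightarrow> 'm spinor \<Rightarrow> bool" where
  "frame_sqk \<mu> \<nu> \<psi> \<longleftrightarrow> smooth_spinor A \<psi> \<and>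
     (\<forall>p j. (\<chi> i. cderiv (e j p) (\<lambda>q. \<psi> q $ i))
        = (\<i>^r * complex_of_real (if j = 1 then \<nu> else \<mu>)) *s (gam r j *v \<psi> p))"

lemma epsilon_cases: "r = 0 \<and> \<epsilon> = 1 \<or> r = Suc 0 \<and> \<epsilon> = -1"
  using r01 by (auto simp: \<epsilon>_def)

lemma powi_eq: "(-1::real) powi (int r - 1) = - \<epsilon>"
  using epsilon_cases by auto

lemma clifford_frame: "clifford r e p (e k p) s = gam r k *v s"
  by (simp add: clifford_def coframe_frame if_distrib[of complex_of_real]
      if_distrib[of "\<lambda>c. c *s _"] cong: if_cong)

lemma clifford_xi: "clifford r e p (\<xi> p) s = gam r 1 *v s"
  using clifford_frame[of p 1] sframe by (simp add: sasakian_frame_def)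

text \<open>Moving the spin connection to the right subtracts \<epsilon> / 2 along every frame
  vector, because (-i)^r = \<epsilon> i^r, and along \<open>e 1\<close> additionally (H -
  \<epsilon>) / 4; there b contributes as well.\<close>

lemma sqk_spinors_imp_frame_sqk:
  assumes "\<psi> \<in> sqk_spinors A r H \<xi> \<eta> e a b"
  shows "frame_sqk (a - \<epsilon> / 2) (a + b - \<epsilon> / 2 - (H - \<epsilon>) / 4) \<psi>"
proof -
  have sm: "smooth_spinor A \<psi>" and
    D: "\<And>j p. spin_nabla r H e (e j) \<psi> p = (complex_of_real a * \<i>^r) *s clifford r e p (e j p) (\<psi> p)
               + (complex_of_real b * \<i>^r * complex_of_real (\<eta> p (e j p))) *s clifford r e p (\<xi> p) (\<psi> p)"
    using assms frame_vfield by (auto simp: sqk_spinors_def)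
  have "(\<chi> i. cderiv (e j p) (\<lambda>q. \<psi> q $ i)) = (\<i>^r * complex_of_real
      (if j = 1 then a + b - \<epsilon> / 2 - (H - \<epsilon>) / 4 else a - \<epsilon> / 2)) *s (gam r j *v \<psi> p)" for j p
  proof -
    define G where "G = gam r j *v \<psi> p"
    define \<delta> where "\<delta> = (if j = 1 then 1 else 0 :: real)"
    have con: "spin_connection r H e p (e j p) (\<psi> p)
        = ((- \<i>)^r / 2) *s G + (\<i>^r * complex_of_real ((H - \<epsilon>) / 4 * \<delta>)) *s (gam r 1 *v \<psi> p)"
      using clifford_frame[of p j "\<psi> p"]
      by (simp add: spin_connection_def clifford_def powi_eq coframe_frame \<delta>_def G_def)
    have "(- \<i>)^r / 2 = \<i>^r * complex_of_real (\<epsilon> / 2)"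
      using epsilon_cases by auto
    moreover have "(\<chi> i. cderiv (e j p) (\<lambda>q. \<psi> q $ i)) = (complex_of_real a * \<i>^r) *s G
        + (complex_of_real b * \<i>^r * complex_of_real \<delta>) *s (gam r 1 *v \<psi> p)
        - (((- \<i>)^r / 2) *s G + (\<i>^r * complex_of_real ((H - \<epsilon>) / 4 * \<delta>)) *s (gam r 1 *v \<psi> p))"
      using D[of j p] unfolding spin_nabla_def con clifford_frame clifford_xi
        eta_eq_coframe[OF frame_tangent]
      by (simp add: coframe_frame \<delta>_def G_def eq_diff_eq)
    ultimately show ?thesis
      by (cases "j = 1") (simp_all add: vec_eq_iff \<delta>_def G_def algebra_simps)
  qed
  then show ?thesis
    using sm by (simp add: frame_sqk_def)
qed

lemma frame_sqk_csmooth: "frame_sqk \<mu> \<nu> \<psi> \<Longrightarrow> csmooth A (\<lambda>p. \<psi> p $ i)"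
  by (simp add: frame_sqk_def smooth_spinor_def csmooth_def)

lemma frame_sqk_cderiv:
  assumes "frame_sqk \<mu> \<nu> \<psi>"
  shows "cderiv (e j p) (\<lambda>q. \<psi> q $ i)
    = \<i>^r * complex_of_real (if j = 1 then \<nu> else \<mu>) * (gam r j *v \<psi> p) $ i"
proof -
  have "(\<chi> i. cderiv (e j p) (\<lambda>q. \<psi> q $ i)) $ i
      = ((\<i>^r * complex_of_real (if j = 1 then \<nu> else \<mu>)) *s (gam r j *v \<psi> p)) $ i"
    using assms by (simp add: frame_sqk_def)
  then show ?thesis by simp
qed

lemma cderiv_bilinear:
  assumes s: "frame_sqk \<mu> \<nu> s" and t: "frame_sqk \<mu>' \<nu>' t"
  shows "csmooth A (\<lambda>q. cnj (s q $ i) * t q $ k)"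
    and "cderiv (e j p) (\<lambda>q. cnj (s q $ i) * t q $ k)
      = cnj (s p $ i) * cderiv (e j p) (\<lambda>q. t q $ k) + cnj (cderiv (e j p) (\<lambda>q. s q $ i)) * t p $ k"
  by (simp_all add: csmooth_intros cderiv_rules[OF frame_tangent] frame_sqk_csmooth[OF s]
      frame_sqk_csmooth[OF t])

lemma csmooth_spin_current:
  assumes s: "frame_sqk \<mu> \<nu> s" and t: "frame_sqk \<mu>' \<nu>' t"
  shows "csmooth A (\<lambda>q. spin_current r j (s q) (t q))"
  unfolding spin_current_def
  by (cases "r = 0"; cases "j = 1"; cases "j = 2"; simp)
    (intro csmooth_intros cderiv_bilinear(1)[OF s t])+

lemma cderiv_spin_scalar:
  assumes s: "frame_sqk \<mu> \<nu> s" and t: "frame_sqk \<mu>' \<nu>' t"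
  shows "cderiv (e 2 p) (\<lambda>q. spin_scalar r (s q) (t q))
      = \<i> * complex_of_real (\<epsilon> * (\<mu>' - \<mu>)) * spin_current r 2 (s p) (t p)"
    and "cderiv (e 3 p) (\<lambda>q. spin_scalar r (s q) (t q))
      = \<i> * complex_of_real (\<epsilon> * (\<mu>' - \<mu>)) * spin_current r 3 (s p) (t p)"
  using epsilon_cases
  by (elim disjE conjE; simp add: spin_scalar_def spin_current_def cderiv_rules[OF frame_tangent]
      csmooth_intros cderiv_bilinear[OF s t] frame_sqk_cderiv[OF s] frame_sqk_cderiv[OF t] gam_mult;
      simp add: algebra_simps)+

text \<open>In both signatures i^r times a gamma matrix is skew for the invariant form.
  Differentiating the pairing with gamma_k along e_j therefore yields gamma_k gamma_j with the
  parameter of t minus gamma_j gamma_k with that of s: a difference of parameters times the scalar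
  if j = k, and, by anticommutation, a sum times the third component otherwise.\<close>

lemma cderiv_spin_current:
  assumes s: "frame_sqk \<mu> \<nu> s" and t: "frame_sqk \<mu>' \<nu>' t"
  defines "P \<equiv> \<lambda>j p. spin_current r j (s p) (t p)"
  shows "cderiv (e 1 p) (P 1) = \<i> * complex_of_real (\<nu>' - \<nu>) * spin_scalar r (s p) (t p)"
    and "cderiv (e 1 p) (P 2) = complex_of_real (\<nu> + \<nu>') * P 3 p"
    and "cderiv (e 1 p) (P 3) = - complex_of_real (\<nu> + \<nu>') * P 2 p"
    and "cderiv (e 2 p) (P 1) = - complex_of_real (\<epsilon> * (\<mu> + \<mu>')) * P 3 p"
    and "cderiv (e 2 p) (P 2) = \<i> * complex_of_real (\<mu>' - \<mu>) * spin_scalar r (s p) (t p)"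
    and "cderiv (e 2 p) (P 3) = complex_of_real (\<mu> + \<mu>') * P 1 p"
    and "cderiv (e 3 p) (P 1) = complex_of_real (\<epsilon> * (\<mu> + \<mu>')) * P 2 p"
    and "cderiv (e 3 p) (P 2) = - complex_of_real (\<mu> + \<mu>') * P 1 p"
    and "cderiv (e 3 p) (P 3) = \<i> * complex_of_real (\<mu>' - \<mu>) * spin_scalar r (s p) (t p)"
  using epsilon_cases
  by (elim disjE conjE; simp add: P_def spin_scalar_def spin_current_def cderiv_rules[OF frame_tangent]
      csmooth_intros cderiv_bilinear[OF s t] frame_sqk_cderiv[OF s] frame_sqk_cderiv[OF t] gam_mult;
      simp add: algebra_simps)+

lemma closed2_F_form_iff:
  assumes s: "frame_sqk \<mu> \<nu> s" and t: "frame_sqk \<mu>' \<nu>' t"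
  shows "closed2 A (F_form r e s t) \<longleftrightarrow>
    (\<nu>' - \<nu>) + 2 * (\<mu>' - \<mu>) = 0 \<or> (\<forall>p. spin_scalar r (s p) (t p) = 0)"
proof -
  have sm: "csmooth A (\<lambda>q. 2 * spin_current r j (s q) (t q))" for j
    by (intro csmooth_intros csmooth_spin_current[OF s t])
  have "(\<Sum>j\<in>UNIV. cderiv (e j p) (\<lambda>q. 2 * spin_current r j (s q) (t q)))
      = 2 * \<i> * complex_of_real ((\<nu>' - \<nu>) + 2 * (\<mu>' - \<mu>)) * spin_scalar r (s p) (t p)" for p
    by (simp add: sum_3 cderiv_rules[OF frame_tangent] csmooth_const csmooth_spin_current[OF s t]
        cderiv_spin_current[OF s t] algebra_simps)
  then show ?thesis
    unfolding F_form_eq[OF r01] closed2_two_form_of[OF sm]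
    by (simp del: of_real_add of_real_diff of_real_mult)
qed

lemma maxwell_iff:
  assumes s: "frame_sqk \<mu> \<nu> s" and t: "frame_sqk \<mu>' \<nu>' t"
  shows "maxwell A r g e s t c \<longleftrightarrow>
    (\<forall>p. (4 + 4 * \<epsilon> * (\<mu> + \<mu>') = c \<or> spin_current r 1 (s p) (t p) = 0) \<and>
      (2 * \<epsilon> * (\<nu> + \<nu>' + \<mu> + \<mu>' + \<kappa>) = c \<or>
        spin_current r 2 (s p) (t p) = 0 \<and> spin_current r 3 (s p) (t p) = 0))"
proof -
  define P where "P = (\<lambda>j p. spin_current r j (s p) (t p))"
  \<comment> \<open>Components of the Hodge dual of F relative to the current: 2 comes from F, and
    \<epsilon> from raising the index 1.\<close>
  define a where "a = (\<lambda>j::3. if j = 1 then 2 else complex_of_real (2 * \<epsilon>))"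
  \<comment> \<open>In \<open>c1\<close> the summand 4 comes from the bracket of \<open>e 2\<close>
    and \<open>e 3\<close>; in \<open>c2\<close> the summand \<kappa> comes from the brackets with
    \<open>e 1\<close>. All other terms are derivatives of the current.\<close>
  define c1 where "c1 = 4 + 4 * \<epsilon> * (\<mu> + \<mu>')"
  define c2 where "c2 = 2 * \<epsilon> * (\<nu> + \<nu>' + \<mu> + \<mu>' + \<kappa>)"
  have Ps: "csmooth A (P j)" for j
    unfolding P_def by (rule csmooth_spin_current[OF s t])
  have 1: "hodge2 r e (F_form r e s t) = one_form_of (\<lambda>j p. a j * P j p)"
    unfolding F_form_eq[OF r01] hodge2_eq two_form_of_frame
    by (rule arg_cong[of _ _ one_form_of]) (auto simp: fun_eq_iff forall_3 a_def P_def \<epsilon>_def)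
  have dP: "cderiv (e k p) (\<lambda>q. a j * P j q) = a j * cderiv (e k p) (P j)" for j k p
    by (simp add: cderiv_rules[OF frame_tangent] csmooth_const Ps)
  have "(\<lambda>q. spin_current r j (s q) (t q)) = P j" "spin_current r j (s p) (t p) = P j p" for j p
    by (simp_all add: P_def)
  note dP' = cderiv_spin_current[OF s t, unfolded this]
  have 2: "hodge2 r e (ext_d1 (one_form_of (\<lambda>j p. a j * P j p)))
      = one_form_of (\<lambda>j p. complex_of_real (if j = 1 then c1 else \<epsilon> * c2) * P j p)"
    unfolding hodge2_eq ext_d1_frame dP dP'
    using epsilon_cases
    by (intro arg_cong[of _ _ one_form_of])
      (auto simp: fun_eq_iff forall_3 a_def c1_def c2_def field_simps)
  \<comment> \<open>The sign (-1)^(r-1) = - \<epsilon> meets J = - P, and lowering the index 1 gives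
    another \<epsilon>, so the first component loses its sign.\<close>
  have 3: "complex_of_real ((-1) powi (int r - 1)) * complex_of_real c * flat g e (J_current r s t) X p
      = one_form_of (\<lambda>j p. complex_of_real (if j = 1 then c else \<epsilon> * c) * P j p) X p"
    if X: "X \<in> vfields A" for X p
  proof -
    have T: "X p \<in> tangent_space A p" using X by (simp add: vfields_def)
    show ?thesis
      using epsilon_cases
      by (auto simp: flat_def one_form_of_def J_current_eq[OF r01] metric_frame[OF T] sum_3 sig_def
          P_def algebra_simps)
  qed
  have "maxwell A r g e s t c \<longleftrightarrow> (\<forall>X\<in>vfields A. \<forall>p.
      one_form_of (\<lambda>j p. complex_of_real (if j = 1 then c1 else \<epsilon> * c2) * P j p) X p
      = one_form_of (\<lambda>j p. complex_of_real (if j = 1 then c else \<epsilon> * c) * P j p) X p)"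
    unfolding maxwell_def 1 2 using 3 by simp
  also have "\<dots> \<longleftrightarrow> (\<forall>j p. complex_of_real (if j = 1 then c1 else \<epsilon> * c2) * P j p
      = complex_of_real (if j = 1 then c else \<epsilon> * c) * P j p)"
    by (rule one_form_of_eq_iff)
  also have "\<dots> \<longleftrightarrow> (\<forall>p. (c1 = c \<or> P 1 p = 0) \<and> (c2 = c \<or> P 2 p = 0 \<and> P 3 p = 0))"
    using epsilon_cases by (auto simp: forall_3)
  finally show ?thesis
    by (simp add: P_def c1_def c2_def)
qed

end

section \<open>Maxwell equation for the three classes\<close>

lemma gam1_eigenvector_iff:
  assumes "r \<in> {0, 1}"
  shows "(\<exists>l. gam r 1 *v t = l *s t) \<longleftrightarrow> t $ 2 = t $ 1 \<or> t $ 2 = - t $ 1"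
proof -
  define c :: complex where "c = (if r = 0 then \<i> else 1)"
  have c: "c \<noteq> 0" by (simp add: c_def)
  have "gam r 1 *v t = l *s t \<longleftrightarrow> c * t $ 2 = l * t $ 1 \<and> c * t $ 1 = l * t $ 2" for l
    using assms by (auto simp: vec_eq_iff forall_2 gam_mult c_def)
  moreover have "(\<exists>l. c * t $ 2 = l * t $ 1 \<and> c * t $ 1 = l * t $ 2) \<longleftrightarrow> t $ 2 = t $ 1 \<or> t $ 2 = - t $ 1"
  proof
    assume "\<exists>l. c * t $ 2 = l * t $ 1 \<and> c * t $ 1 = l * t $ 2"
    then obtain l where "c * t $ 2 = l * t $ 1" "c * t $ 1 = l * t $ 2" by blast
    then have "c * (t $ 2 * t $ 2) = c * (t $ 1 * t $ 1)"
      by (metis mult.assoc mult.commute)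
    then show "t $ 2 = t $ 1 \<or> t $ 2 = - t $ 1"
      using c by (simp add: square_eq_iff)
  next
    assume "t $ 2 = t $ 1 \<or> t $ 2 = - t $ 1"
    then show "\<exists>l. c * t $ 2 = l * t $ 1 \<and> c * t $ 1 = l * t $ 2"
      by (elim disjE) (rule exI[of _ c] exI[of _ "- c"]; simp)+
  qed
  ultimately show ?thesis by simp
qed

text \<open>The equations equate the component ratio k of t with both the conjugated ratio for s and
  its inverse. Thus k * k = 1, and both spinors lie on the same eigenline of \<sigma>1.\<close>

lemma spin_current_23_eq_0_imp:
  assumes r: "r \<in> {0, 1}" and s: "s \<noteq> 0" and t: "t \<noteq> 0"
    and 0: "spin_current r 2 s t = 0" "spin_current r 3 s t = 0"
  obtains c k where "k = 1 \<or> k = -1" "s = c *s t" "s $ 2 = k * s $ 1" "t $ 2 = k * t $ 1"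
proof -
  have e: "cnj (s $ 2) * t $ 1 = cnj (s $ 1) * t $ 2" "cnj (s $ 1) * t $ 1 = cnj (s $ 2) * t $ 2"
    using 0 spin_current_23_eq_0_iff[OF r, of s t] by auto
  have t1: "t $ 1 \<noteq> 0"
    using e s t by (auto simp: vec_eq_iff forall_2)
  define k where "k = t $ 2 / t $ 1"
  have tk: "t $ 2 = k * t $ 1" using t1 by (simp add: k_def)
  have sk: "cnj (s $ 2) = cnj (s $ 1) * k" "cnj (s $ 1) = cnj (s $ 2) * k"
    using e t1 by (simp_all add: tk flip: mult.assoc)
  have s1: "s $ 1 \<noteq> 0"
    using sk s by (auto simp: vec_eq_iff forall_2)
  have "cnj (s $ 1) * (k * k) = cnj (s $ 1) * 1"
    using sk by (metis mult.assoc mult.right_neutral)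
  then have "k * k = 1" using s1 by (simp only: mult_cancel_left) simp
  then have k: "k = 1 \<or> k = -1" by (simp add: square_eq_1_iff)
  \<comment> \<open>Being 1 or -1, k is unchanged by conjugation.\<close>
  have s2: "s $ 2 = k * s $ 1"
    using arg_cong[OF sk(1), of cnj] k by auto
  have "s = (s $ 1 / t $ 1) *s t"
    using t1 tk s2 by (simp add: vec_eq_iff forall_2)
  then show thesis using that k s2 tk by blast
qed

context sasakian_framed
begin

text \<open>Gamma matrices permute the two components up to factors of modulus one, so the frame
  derivatives of the four real and imaginary parts are bounded by the sum of their absolute values.
  Unique continuation applies.\<close>

lemma frame_sqk_zero:
  assumes \<psi>: "frame_sqk \<mu> \<nu> \<psi>" and p: "\<psi> p = 0"
  shows "\<psi> q = 0"
proof -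
  define \<phi> where "\<phi> = (\<lambda>k::nat. if k = 0 then (\<lambda>p. Re (\<psi> p $ 1)) else if k = 1 then (\<lambda>p. Im (\<psi> p $ 1))
     else if k = 2 then (\<lambda>p. Re (\<psi> p $ 2)) else (\<lambda>p. Im (\<psi> p $ 2)))"
  define \<Phi> where "\<Phi> = (\<lambda>p. \<bar>Re (\<psi> p $ 1)\<bar> + \<bar>Im (\<psi> p $ 1)\<bar> + (\<bar>Re (\<psi> p $ 2)\<bar> + \<bar>Im (\<psi> p $ 2)\<bar>))"
  define C where "C = \<bar>\<mu>\<bar> + \<bar>\<nu>\<bar>"
  have \<Phi>: "(\<Sum>k\<in>{0, 1, 2, 3}. \<bar>\<phi> k p\<bar>) = \<Phi> p" for p
    by (simp add: \<phi>_def \<Phi>_def)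
  have bound: "cmod (cderiv (e j p) (\<lambda>q. \<psi> q $ i)) \<le> C * \<Phi> p" for i j p
  proof -
    have "cmod (\<psi> p $ k) \<le> \<Phi> p" for k
    proof -
      have "cmod (\<psi> p $ 1) \<le> \<Phi> p" "cmod (\<psi> p $ 2) \<le> \<Phi> p"
        using cmod_le[of "\<psi> p $ 1"] cmod_le[of "\<psi> p $ 2"] unfolding \<Phi>_def by linarith+
      then show ?thesis using exhaust_2[of k] by auto
    qed
    then have "cmod ((gam r j *v \<psi> p) $ i) \<le> \<Phi> p"
      using epsilon_cases exhaust_2[of i] exhaust_3[of j] by (auto simp: gam_mult norm_mult)
    moreover have "\<bar>if j = 1 then \<nu> else \<mu>\<bar> \<le> C" by (simp add: C_def)
    ultimately show ?thesis
      unfolding frame_sqk_cderiv[OF \<psi>]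
      by (simp add: norm_mult norm_power mult_mono del: if_distrib)
  qed
  have b: "\<bar>e j p (\<lambda>q. Re (\<psi> q $ i))\<bar> \<le> C * \<Phi> p" "\<bar>e j p (\<lambda>q. Im (\<psi> q $ i))\<bar> \<le> C * \<Phi> p" for i j p
    using bound[of j p i] abs_Re_le_cmod[of "cderiv (e j p) (\<lambda>q. \<psi> q $ i)"]
      abs_Im_le_cmod[of "cderiv (e j p) (\<lambda>q. \<psi> q $ i)"] by (simp_all add: cderiv_def)
  have "smooth_fun A (\<phi> k)" for k
    using frame_sqk_csmooth[OF \<psi>] by (simp add: \<phi>_def csmooth_def)
  moreover have "\<bar>e j p (\<phi> k)\<bar> \<le> C * (\<Sum>k\<in>{0, 1, 2, 3}. \<bar>\<phi> k p\<bar>)" for j p k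
    unfolding \<Phi> using b by (simp add: \<phi>_def)
  moreover have "\<phi> k p = 0" for k using p by (simp add: \<phi>_def)
  moreover have "C \<ge> 0" by (simp add: C_def)
  ultimately have "\<phi> k q = 0" if "k \<in> {0, 1, 2, 3}" for k
    using unique_continuation[OF connected_manifold, of "{0, 1, 2, 3}" \<phi> C p k q] that by blast
  from this[of 0] this[of 1] this[of 2] this[of 3] show ?thesis
    by (simp add: \<phi>_def vec_eq_iff forall_2 complex_eq_iff)
qed

lemma frame_sqk_nonzero:
  "frame_sqk \<mu> \<nu> \<psi> \<Longrightarrow> \<exists>p. \<psi> p \<noteq> 0 \<Longrightarrow> \<psi> q \<noteq> 0"
  using frame_sqk_zero by blast

text \<open>Subtracting the value at q keeps the type (0, 0) and creates a zero, which spreads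
  everywhere.\<close>

lemma frame_sqk_const:
  assumes \<psi>: "frame_sqk 0 0 \<psi>"
  shows "\<psi> p = \<psi> q"
proof -
  have "frame_sqk 0 0 (\<lambda>p. \<psi> p - \<psi> q)"
    using \<psi> frame_sqk_csmooth[OF \<psi>] frame_sqk_cderiv[OF \<psi>]
    by (simp add: frame_sqk_def smooth_spinor_def smooth_fun_diff smooth_fun_const vec_eq_iff
        cderiv_rules[OF frame_tangent] csmooth_const)
  then have "\<psi> p - \<psi> q = 0" by (rule frame_sqk_zero) simp
  then show ?thesis by simp
qed

text \<open>The two expressions for the derivative along \<open>e 2\<close> differ by (\<mu> -
  \<mu>') times an invertible matrix applied to \<psi>.\<close>

lemma frame_sqk_unique:
  assumes "frame_sqk \<mu> \<nu> \<psi>" "frame_sqk \<mu>' \<nu>' \<psi>" "\<mu> \<noteq> \<mu>'"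
  shows "\<psi> p = 0"
proof -
  have "\<i>^r * complex_of_real \<mu> * (gam r 2 *v \<psi> p) $ i = \<i>^r * complex_of_real \<mu>' * (gam r 2 *v \<psi> p) $ i" for i
    using frame_sqk_cderiv[OF assms(1), of 2 p i] frame_sqk_cderiv[OF assms(2), of 2 p i] by auto
  from this[of 1] this[of 2] show ?thesis
    using assms(3) by (simp add: gam_mult vec_eq_iff forall_2)
qed

text \<open>If the scalar vanished identically, its derivatives along \<open>e 2\<close> and
  \<open>e 3\<close> would annihilate the second and third current components as \<mu> \<noteq>
  \<mu>', and one spinor would be zero.\<close>

lemma closed2_F_form_distinct_iff:
  assumes s: "frame_sqk \<mu> \<nu> s" "\<exists>p. s p \<noteq> 0" and t: "frame_sqk \<mu>' \<nu>' t" "\<exists>p. t p \<noteq> 0"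
    and ne: "\<mu> \<noteq> \<mu>'"
  shows "closed2 A (F_form r e s t) \<longleftrightarrow> (\<nu>' - \<nu>) + 2 * (\<mu>' - \<mu>) = 0"
proof -
  have False if N: "\<forall>p. spin_scalar r (s p) (t p) = 0"
  proof -
    fix p
    have "cderiv (e j p) (\<lambda>q. spin_scalar r (s q) (t q)) = 0" for j
      using N by (simp add: cderiv_const[OF frame_tangent])
    then have "spin_current r 2 (s p) (t p) = 0" "spin_current r 3 (s p) (t p) = 0"
      using cderiv_spin_scalar[OF s(1) t(1), of p] ne epsilon_cases by auto
    then have "s p = 0 \<or> t p = 0"
      using N spin_scalar_current_nonzero[OF r01] by blast
    then show False
      using frame_sqk_nonzero[OF s] frame_sqk_nonzero[OF t] by blast
  qed
  then show ?thesis
    using closed2_F_form_iff[OF s(1) t(1)] by blast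
qed

lemma spin_current_not_all_zero:
  assumes s: "frame_sqk \<mu> \<nu> s" "\<exists>p. s p \<noteq> 0" and t: "frame_sqk \<mu>' \<nu>' t" "\<exists>p. t p \<noteq> 0"
  shows "\<not> (spin_current r 1 (s p) (t p) = 0 \<and> spin_current r 2 (s p) (t p) = 0 \<and>
    spin_current r 3 (s p) (t p) = 0)"
  using spin_current_nonzero[OF r01, of "s p" "t p"] frame_sqk_nonzero[OF s] frame_sqk_nonzero[OF t]
    exhaust_3 by metis

lemma maxwell_uniform:
  assumes s: "frame_sqk \<mu> \<nu> s" "\<exists>p. s p \<noteq> 0" and t: "frame_sqk \<mu>' \<nu>' t" "\<exists>p. t p \<noteq> 0"
    and "4 + 4 * \<epsilon> * (\<mu> + \<mu>') = k" "2 * \<epsilon> * (\<nu> + \<nu>' + \<mu> + \<mu>' + \<kappa>) = k"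
  shows "maxwell A r g e s t c \<longleftrightarrow> c = k"
  unfolding maxwell_iff[OF s(1) t(1)] assms(5,6)
  using spin_current_not_all_zero[OF s t] by blast

text \<open>Neither coefficient equation can be evaded. A vanishing first component forces the
  others to vanish through its derivatives along \<open>e 2\<close> and \<open>e 3\<close>;
  vanishing second and third components force the first through the derivative of the third along
  \<open>e 2\<close>. Both use \<mu> \<noteq> 0.\<close>

lemma maxwell_same_type:
  assumes s: "frame_sqk \<mu> (- \<kappa> / 2) s" "\<exists>p. s p \<noteq> 0" and t: "frame_sqk \<mu> (- \<kappa> / 2) t" "\<exists>p. t p \<noteq> 0"
    and \<mu>: "\<mu> \<noteq> 0"
  shows "maxwell A r g e s t c \<longleftrightarrow> \<epsilon> * \<mu> = -1 \<and> c = -4"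
proof
  assume "\<epsilon> * \<mu> = -1 \<and> c = -4"
  then show "maxwell A r g e s t c"
    using maxwell_uniform[OF s t, of "-4" c] by (simp add: algebra_simps)
next
  assume "maxwell A r g e s t c"
  then have m: "4 + 4 * \<epsilon> * (\<mu> + \<mu>) = c \<or> spin_current r 1 (s p) (t p) = 0"
      "4 * \<epsilon> * \<mu> = c \<or> spin_current r 2 (s p) (t p) = 0 \<and> spin_current r 3 (s p) (t p) = 0" for p
    using maxwell_iff[OF s(1) t(1)] by (simp_all add: algebra_simps)
  note d = cderiv_spin_current[OF s(1) t(1)] and z = cderiv_const[OF frame_tangent]
  have \<epsilon>: "\<epsilon> \<noteq> 0" using epsilon_cases by auto
  have 1: "4 + 4 * \<epsilon> * (\<mu> + \<mu>) = c"
  proof (rule ccontr)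
    assume "\<not> ?thesis"
    then have P: "spin_current r 1 (s p) (t p) = 0" for p using m(1) by blast
    then have "spin_current r 2 (s p) (t p) = 0" "spin_current r 3 (s p) (t p) = 0" for p
      using d(4,7)[of p] \<mu> \<epsilon> by (simp_all add: z flip: of_real_add)
    then show False using P spin_current_not_all_zero[OF s t] by blast
  qed
  have 2: "4 * \<epsilon> * \<mu> = c"
  proof (rule ccontr)
    assume "\<not> ?thesis"
    then have P: "spin_current r 2 (s p) (t p) = 0" "spin_current r 3 (s p) (t p) = 0" for p
      using m(2) by blast+
    then have "spin_current r 1 (s p) (t p) = 0" for p
      using d(6)[of p] \<mu> by (simp add: z flip: of_real_add)
    then show False using P spin_current_not_all_zero[OF s t] by blast
  qed
  from 1 2 show "\<epsilon> * \<mu> = -1 \<and> c = -4" by (simp add: algebra_simps)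
qed

text \<open>For constant spinors differentiation gives no further constraint, so both escapes
  remain: V removes the first component and I the other two. They exclude each other because the
  current has no zeros.\<close>

lemma maxwell_constant:
  assumes s: "frame_sqk 0 0 s" "\<exists>p. s p \<noteq> 0" and t: "frame_sqk 0 0 t" "\<exists>p. t p \<noteq> 0"
  defines "I \<equiv> proportional s t \<and> eigen_spinor r e \<xi> s \<and> eigen_spinor r e \<xi> t"
    and "V \<equiv> \<forall>p. spin_form r (s p) (gam r 1 *v t p) = 0"
  shows "maxwell A r g e s t c \<longleftrightarrow> (c = 4 \<or> V) \<and> (c = 3 + \<epsilon> * H \<or> I)" and "\<not> (V \<and> I)"
proof -
  fix p
  have sp: "s q = s p" and tp: "t q = t p" for q
    using frame_sqk_const[OF s(1)] frame_sqk_const[OF t(1)] by blast+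
  have s0: "s p \<noteq> 0" and t0: "t p \<noteq> 0"
    using frame_sqk_nonzero[OF s] frame_sqk_nonzero[OF t] by auto
  have all: "(\<forall>q. R (s q) (t q)) \<longleftrightarrow> R (s p) (t p)" for R
    using sp tp by metis
  have V: "V \<longleftrightarrow> spin_current r 1 (s p) (t p) = 0"
    unfolding V_def spin_form_gam1_eq_0_iff[OF r01] by (rule all)
  have eig: "eigen_spinor r e \<xi> u \<longleftrightarrow> u p $ 2 = u p $ 1 \<or> u p $ 2 = - u p $ 1"
    if "\<And>q. u q = u p" for u
    unfolding eigen_spinor_def clifford_xi gam1_eigenvector_iff[OF r01, symmetric] using that by metis
  have pr: "proportional s t \<longleftrightarrow> (\<exists>c. s p = c *s t p)"
    unfolding proportional_def using sp tp by metis
  have I: "I \<longleftrightarrow> spin_current r 2 (s p) (t p) = 0 \<and> spin_current r 3 (s p) (t p) = 0"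
  proof
    assume I
    then obtain c where c: "s p = c *s t p" and "t p $ 2 = t p $ 1 \<or> t p $ 2 = - t p $ 1"
      unfolding I_def pr using eig[of t] tp by blast
    then show "spin_current r 2 (s p) (t p) = 0 \<and> spin_current r 3 (s p) (t p) = 0"
      unfolding spin_current_23_eq_0_iff[OF r01] by auto
  next
    assume "spin_current r 2 (s p) (t p) = 0 \<and> spin_current r 3 (s p) (t p) = 0"
    then obtain c k where "k = 1 \<or> k = -1" "s p = c *s t p" "s p $ 2 = k * s p $ 1" "t p $ 2 = k * t p $ 1"
      using spin_current_23_eq_0_imp[OF r01 s0 t0] by blast
    then show I
      unfolding I_def pr eig[of s, OF sp] eig[of t, OF tp] by auto
  qed
  have "2 * \<epsilon> * \<kappa> = 3 + \<epsilon> * H"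
    using epsilon_cases by (auto simp: \<kappa>_def)
  then show "maxwell A r g e s t c \<longleftrightarrow> (c = 4 \<or> V) \<and> (c = 3 + \<epsilon> * H \<or> I)"
    unfolding maxwell_iff[OF s(1) t(1)] V I
    by (subst all[of "\<lambda>u v. (_ \<or> spin_current r 1 u v = 0) \<and>
        (_ \<or> spin_current r 2 u v = 0 \<and> spin_current r 3 u v = 0)"]) auto
  show "\<not> (V \<and> I)"
    unfolding V I using spin_current_not_all_zero[OF s t, of p] by blast
qed

section \<open>Types of the three classes\<close>

abbreviation "S\<^sub>0 \<equiv> S_zero A r H \<xi> \<eta> e"
abbreviation "S\<^sub>p \<equiv> S_plus A r H \<xi> \<eta> e"
abbreviation "S\<^sub>m \<equiv> S_minus A r H \<xi> \<eta> e"

definition Q :: real where "Q = sqrt (3 + \<epsilon> * H)"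

lemma S_zero_imp: "\<psi> \<in> S\<^sub>0 \<Longrightarrow> frame_sqk 0 0 \<psi>"
  unfolding S_zero_def \<epsilon>_def[symmetric] by (drule sqk_spinors_imp_frame_sqk) simp

lemma S_plus_imp: "\<psi> \<in> S\<^sub>p \<Longrightarrow> 3 + \<epsilon> * H > 0 \<and> frame_sqk (Q / 2) (- \<kappa> / 2) \<psi>"
proof -
  assume "\<psi> \<in> S\<^sub>p"
  then have *: "3 + \<epsilon> * H > 0"
    "frame_sqk ((\<epsilon> + Q) / 2 - \<epsilon> / 2) ((\<epsilon> + Q) / 2 + (- \<epsilon> * 2 - Q) / 2 - \<epsilon> / 2 - (H - \<epsilon>) / 4) \<psi>"
    unfolding S_plus_def \<epsilon>_def[symmetric] powi_eq Q_def[symmetric]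
    by (auto dest: sqk_spinors_imp_frame_sqk)
  have eq: "(\<epsilon> + Q) / 2 - \<epsilon> / 2 = Q / 2"
    "(\<epsilon> + Q) / 2 + (- \<epsilon> * 2 - Q) / 2 - \<epsilon> / 2 - (H - \<epsilon>) / 4 = - \<kappa> / 2"
    by (simp_all add: \<kappa>_def field_simps)
  show ?thesis using * unfolding eq by blast
qed

lemma S_minus_imp: "\<psi> \<in> S\<^sub>m \<Longrightarrow> 3 + \<epsilon> * H > 0 \<and> frame_sqk (- Q / 2) (- \<kappa> / 2) \<psi>"
proof -
  assume "\<psi> \<in> S\<^sub>m"
  then have *: "3 + \<epsilon> * H > 0"
    "frame_sqk ((\<epsilon> - Q) / 2 - \<epsilon> / 2) ((\<epsilon> - Q) / 2 + (- \<epsilon> * 2 + Q) / 2 - \<epsilon> / 2 - (H - \<epsilon>) / 4) \<psi>"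
    unfolding S_minus_def \<epsilon>_def[symmetric] powi_eq Q_def[symmetric]
    by (auto dest: sqk_spinors_imp_frame_sqk)
  have eq: "(\<epsilon> - Q) / 2 - \<epsilon> / 2 = - Q / 2"
    "(\<epsilon> - Q) / 2 + (- \<epsilon> * 2 + Q) / 2 - \<epsilon> / 2 - (H - \<epsilon>) / 4 = - \<kappa> / 2"
    by (simp_all add: \<kappa>_def field_simps)
  show ?thesis using * unfolding eq by blast
qed

lemma kappa_eq:
  assumes "3 + \<epsilon> * H > 0"
  shows "Q > 0" "Q * Q = 3 + \<epsilon> * H" "\<kappa> = \<epsilon> * (Q * Q) / 2"
proof -
  show "Q > 0" "Q * Q = 3 + \<epsilon> * H" using assms by (simp_all add: Q_def)
  then show "\<kappa> = \<epsilon> * (Q * Q) / 2"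
    using epsilon_cases by (auto simp: \<kappa>_def)
qed

text \<open>The parameters \<mu> are 0, Q / 2 and - Q / 2 with Q > 0, and a nonzero spinor
  determines its \<mu>. The case distinction by membership is thereby exclusive.\<close>

lemma S_disjoint:
  assumes "\<exists>p. \<psi> p \<noteq> 0"
  shows "\<psi> \<in> S\<^sub>0 \<Longrightarrow> \<psi> \<notin> S\<^sub>p \<and> \<psi> \<notin> S\<^sub>m" "\<psi> \<in> S\<^sub>p \<Longrightarrow> \<psi> \<notin> S\<^sub>0 \<and> \<psi> \<notin> S\<^sub>m"
    "\<psi> \<in> S\<^sub>m \<Longrightarrow> \<psi> \<notin> S\<^sub>0 \<and> \<psi> \<notin> S\<^sub>p"
proof -
  have "\<not> (\<psi> \<in> S\<^sub>0 \<and> \<psi> \<in> S\<^sub>p)" "\<not> (\<psi> \<in> S\<^sub>0 \<and> \<psi> \<in> S\<^sub>m)" "\<not> (\<psi> \<in> S\<^sub>p \<and> \<psi> \<in> S\<^sub>m)"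
    using frame_sqk_unique[of _ _ \<psi>] S_zero_imp[of \<psi>] S_plus_imp[of \<psi>] S_minus_imp[of \<psi>]
      kappa_eq(1) assms by fastforce+
  then show "\<psi> \<in> S\<^sub>0 \<Longrightarrow> \<psi> \<notin> S\<^sub>p \<and> \<psi> \<notin> S\<^sub>m" "\<psi> \<in> S\<^sub>p \<Longrightarrow> \<psi> \<notin> S\<^sub>0 \<and> \<psi> \<notin> S\<^sub>m"
    "\<psi> \<in> S\<^sub>m \<Longrightarrow> \<psi> \<notin> S\<^sub>0 \<and> \<psi> \<notin> S\<^sub>p" by blast+
qed

text \<open>Pairs of types \<open>(0, 0)\<close> and \<open>(\<sigma> Q / 2, - \<kappa> / 2)\<close>, where \<open>\<sigma>\<close> is a sign: closedness means
  \<open>\<epsilon> \<sigma> Q = 4\<close>.\<close>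

lemma constant_nonconstant_pair:
  assumes Q: "3 + \<epsilon> * H > 0" and \<sigma>: "\<sigma> = 1 \<or> \<sigma> = -1"
    and nz: "\<exists>p. s p \<noteq> 0" "\<exists>p. t p \<noteq> 0"
    and st: "frame_sqk 0 0 s \<and> frame_sqk (\<sigma> * Q / 2) (- \<kappa> / 2) t \<or>
      frame_sqk (\<sigma> * Q / 2) (- \<kappa> / 2) s \<and> frame_sqk 0 0 t"
  shows "closed2 A (F_form r e s t) \<longleftrightarrow> \<epsilon> = \<sigma> \<and> H = 13 * \<sigma>"
    and "\<epsilon> = \<sigma> \<and> H = 13 * \<sigma> \<Longrightarrow> maxwell A r g e s t c \<longleftrightarrow> c = 12"
proof -
  have ne: "0 \<noteq> \<sigma> * Q / 2" "\<sigma> * Q / 2 \<noteq> 0" using \<sigma> kappa_eq(1)[OF Q] by auto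
  have Q4: "Q = 4 \<longleftrightarrow> 3 + \<epsilon> * H = 16"
  proof
    assume "3 + \<epsilon> * H = 16"
    then have "Q = sqrt (4\<^sup>2)" by (simp add: Q_def)
    then show "Q = 4" by simp
  qed (use kappa_eq(2)[OF Q] in simp)
  \<comment> \<open>Since \<kappa> = \<epsilon> Q * Q / 2, the closedness condition carries a common
    factor Q > 0; dividing by it and comparing signs gives Q = 4 and \<epsilon> = \<sigma>.\<close>
  have "\<sigma> * Q = \<kappa> / 2 \<longleftrightarrow> Q * (\<epsilon> * Q) = Q * (4 * \<sigma>)"
  proof -
    have "\<kappa> / 2 = Q * (\<epsilon> * Q) / 4" "Q * (4 * \<sigma>) = 4 * (\<sigma> * Q)"
      by (simp_all add: kappa_eq(3)[OF Q])
    then show ?thesis by linarith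
  qed
  also have "\<dots> \<longleftrightarrow> \<epsilon> * Q = 4 * \<sigma>"
    using kappa_eq(1)[OF Q] by (simp only: mult_cancel_left) simp
  also have "\<dots> \<longleftrightarrow> \<epsilon> = \<sigma> \<and> H = 13 * \<sigma>"
    using Q4 \<sigma> epsilon_cases kappa_eq(1)[OF Q] by auto
  finally have iff: "\<sigma> * Q = \<kappa> / 2 \<longleftrightarrow> \<epsilon> = \<sigma> \<and> H = 13 * \<sigma>" .
  show "closed2 A (F_form r e s t) \<longleftrightarrow> \<epsilon> = \<sigma> \<and> H = 13 * \<sigma>"
    using st
  proof (elim disjE conjE)
    assume "frame_sqk 0 0 s" "frame_sqk (\<sigma> * Q / 2) (- \<kappa> / 2) t"
    from closed2_F_form_distinct_iff[OF this(1) nz(1) this(2) nz(2) ne(1)] show ?thesis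
      unfolding iff[symmetric] by auto
  next
    assume "frame_sqk (\<sigma> * Q / 2) (- \<kappa> / 2) s" "frame_sqk 0 0 t"
    from closed2_F_form_distinct_iff[OF this(1) nz(1) this(2) nz(2) ne(2)] show ?thesis
      unfolding iff[symmetric] by auto
  qed
  show "maxwell A r g e s t c \<longleftrightarrow> c = 12" if h: "\<epsilon> = \<sigma> \<and> H = 13 * \<sigma>"
  \<comment> \<open>With Q = 4 and \<kappa> = 8 \<epsilon> the two Maxwell coefficients coincide: 4
    + 8 and 8 + 4. Hence \<open>maxwell_uniform\<close> applies and c = 12.\<close>
  proof -
    have "Q = 4" using h \<sigma> Q4 by auto
    moreover have "\<kappa> = 8 * \<epsilon>"
      unfolding \<kappa>_def using h by simp
    ultimately have k: "4 + 4 * \<epsilon> * (0 + \<sigma> * Q / 2) = 12" "4 + 4 * \<epsilon> * (\<sigma> * Q / 2 + 0) = 12"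
      "2 * \<epsilon> * (0 + - \<kappa> / 2 + 0 + \<sigma> * Q / 2 + \<kappa>) = 12"
      "2 * \<epsilon> * (- \<kappa> / 2 + 0 + \<sigma> * Q / 2 + 0 + \<kappa>) = 12"
      using h \<sigma> by auto
    show ?thesis
      using st maxwell_uniform[OF _ nz(1) _ nz(2) k(1,3)] maxwell_uniform[OF _ nz(1) _ nz(2) k(2,4)]
      by blast
  qed
qed

end

section \<open>Case analysis over the classes of the two spinors\<close>

theorem proposition3p7:
  fixes A :: "'m::{t2_space,second_countable_topology} chart set"
    and r :: nat and H :: real
    and \<phi> :: "'m endo" and \<xi> :: "'m vfield" and \<eta> :: "'m cotensor1" and g :: "'m cotensor2"
    and e :: "3 \<Rightarrow> 'm vfield" and \<psi>1 \<psi>2 :: "'m spinor"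
    and S0 Sp Sm :: "'m spinor set"
  assumes r: "r \<in> {0, 1}"
    and M: "sasakian_space_form A r \<phi> \<xi> \<eta> g H"
    and e: "sasakian_frame A r \<xi> g H e"
    and S0: "S0 = S_zero A r H \<xi> \<eta> e"
    and Sp: "Sp = S_plus A r H \<xi> \<eta> e"
    and Sm: "Sm = S_minus A r H \<xi> \<eta> e"
    and \<psi>1: "\<psi>1 \<in> S0 \<union> Sp \<union> Sm" "\<exists>p. \<psi>1 p \<noteq> 0"
    and \<psi>2: "\<psi>2 \<in> S0 \<union> Sp \<union> Sm" "\<exists>p. \<psi>2 p \<noteq> 0"
  shows
    "(closed2 A (F_form r e \<psi>1 \<psi>2) \<longleftrightarrow>
        \<psi>1 \<in> S0 \<and> \<psi>2 \<in> S0 \<or>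
        one_in_each S0 Sp \<psi>1 \<psi>2 \<and> H = 13 \<and> r = 0 \<or>
        one_in_each S0 Sm \<psi>1 \<psi>2 \<and> H = -13 \<and> r = 1 \<or>
        \<psi>1 \<in> Sp \<and> \<psi>2 \<in> Sp \<and> (-1)^(r + 1) * H < 3 \<or>
        \<psi>1 \<in> Sm \<and> \<psi>2 \<in> Sm \<and> (-1)^(r + 1) * H < 3)
     \<and> (one_in_each Sp Sm \<psi>1 \<psi>2 \<longrightarrow> \<not> closed2 A (F_form r e \<psi>1 \<psi>2))
     \<and> (closed2 A (F_form r e \<psi>1 \<psi>2) \<longrightarrow>
         (let i = \<psi>1 \<in> S0 \<and> \<psi>2 \<in> S0 \<and> proportional \<psi>1 \<psi>2 \<and>
                  eigen_spinor r e \<xi> \<psi>1 \<and> eigen_spinor r e \<xi> \<psi>2;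
              ii = H = (-1)^r \<and> \<psi>1 \<in> S0 \<and> \<psi>2 \<in> S0;
              iii = H = 13 \<and> r = 0 \<and> one_in_each S0 Sp \<psi>1 \<psi>2;
              iv = H = -13 \<and> r = 1 \<and> one_in_each S0 Sm \<psi>1 \<psi>2;
              v = \<psi>1 \<in> S0 \<and> \<psi>2 \<in> S0 \<and> (\<forall>p. spin_form r (\<psi>1 p) (gam r 1 *v \<psi>2 p) = 0);
              killing' = \<psi>1 \<in> other_killing A r H \<xi> \<eta> e \<and> \<psi>2 \<in> other_killing A r H \<xi> \<eta> e
          in ((\<exists>c. maxwell A r g e \<psi>1 \<psi>2 c) \<longleftrightarrow> i \<or> ii \<or> iii \<or> iv \<or> v \<or> killing')
           \<and> (i \<longrightarrow> (\<forall>c. maxwell A r g e \<psi>1 \<psi>2 c \<longleftrightarrow> c = 4))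
           \<and> (ii \<longrightarrow> (\<forall>c. maxwell A r g e \<psi>1 \<psi>2 c \<longleftrightarrow> c = 4))
           \<and> (iii \<longrightarrow> (\<forall>c. maxwell A r g e \<psi>1 \<psi>2 c \<longleftrightarrow> c = 12))
           \<and> (iv \<longrightarrow> (\<forall>c. maxwell A r g e \<psi>1 \<psi>2 c \<longleftrightarrow> c = 12))
           \<and> (v \<longrightarrow> (\<forall>c. maxwell A r g e \<psi>1 \<psi>2 c \<longleftrightarrow> c = 3 + (-1)^r * H))
           \<and> (killing' \<longrightarrow> (\<forall>c. maxwell A r g e \<psi>1 \<psi>2 c \<longleftrightarrow> c = -4))))"
  proof -
  have "smooth_atlas A" using M by (simp add: sasakian_space_form_def)
  then interpret sasakian_framed A r H \<phi> \<xi> \<eta> g e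
    by unfold_locales (use r M e in auto)
  note nz = \<psi>1(2) \<psi>2(2)
  note dis1 = S_disjoint[OF nz(1), folded S0 Sp Sm] and dis2 = S_disjoint[OF nz(2), folded S0 Sp Sm]
  note imp0 = S_zero_imp[folded S0] and impp = S_plus_imp[folded Sp] and impm = S_minus_imp[folded Sm]
  let ?C = "closed2 A (F_form r e \<psi>1 \<psi>2)"
  let ?M = "maxwell A r g e \<psi>1 \<psi>2"
  let ?V = "\<forall>p. spin_form r (\<psi>1 p) (gam r 1 *v \<psi>2 p) = 0"
  let ?I = "proportional \<psi>1 \<psi>2 \<and> eigen_spinor r e \<xi> \<psi>1 \<and> eigen_spinor r e \<xi> \<psi>2"
  let ?K = "\<psi>1 \<in> other_killing A r H \<xi> \<eta> e \<and> \<psi>2 \<in> other_killing A r H \<xi> \<eta> e"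
  \<comment> \<open>All conditions on H are expressed through 3 + \<epsilon> H, the square of Q,
    which makes the two signatures uniform.\<close>
  have H: "H = \<epsilon> \<longleftrightarrow> 3 + \<epsilon> * H = 4" "(-1)^(r + 1) * H < 3 \<longleftrightarrow> 3 + \<epsilon> * H > 0"
    using epsilon_cases by auto
  have K: "\<psi> \<in> other_killing A r H \<xi> \<eta> e \<longleftrightarrow>
      3 + \<epsilon> * H = 4 \<and> (r = 0 \<and> \<psi> \<in> Sm \<or> r = 1 \<and> \<psi> \<in> Sp)" for \<psi>
    by (simp add: other_killing_def H(1) Sp Sm flip: \<epsilon>_def)
  have \<epsilon>r: "\<epsilon> = 1 \<longleftrightarrow> r = 0" "\<epsilon> = -1 \<longleftrightarrow> r = 1"
    using epsilon_cases by auto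
  have c00: "?C" "(\<exists>c. ?M c) \<longleftrightarrow> ?I \<or> 3 + \<epsilon> * H = 4 \<or> ?V"
      "?I \<Longrightarrow> ?M c \<longleftrightarrow> c = 4" "3 + \<epsilon> * H = 4 \<Longrightarrow> ?M c \<longleftrightarrow> c = 4"
      "?V \<Longrightarrow> ?M c \<longleftrightarrow> c = 3 + \<epsilon> * H"
    if "\<psi>1 \<in> S0" "\<psi>2 \<in> S0" for c
  proof -
    show ?C using closed2_F_form_iff[OF imp0 imp0, OF that] by simp
    \<comment> \<open>The alternatives \<open>?I\<close> and \<open>?V\<close> exclude each other,
      so c is unique in each case: 4 under \<open>?I\<close>, 3 + \<epsilon> H under
      \<open>?V\<close>. If 3 + \<epsilon> H = 4, both equations ask for the same c.\<close>
    note m = maxwell_constant[OF imp0[OF that(1)] nz(1) imp0[OF that(2)] nz(2)]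
    show "(\<exists>c. ?M c) \<longleftrightarrow> ?I \<or> 3 + \<epsilon> * H = 4 \<or> ?V"
      "?I \<Longrightarrow> ?M c \<longleftrightarrow> c = 4" "3 + \<epsilon> * H = 4 \<Longrightarrow> ?M c \<longleftrightarrow> c = 4"
      "?V \<Longrightarrow> ?M c \<longleftrightarrow> c = 3 + \<epsilon> * H"
      unfolding m(1) using m(2) by metis+
  qed
  have c0p: "?C \<longleftrightarrow> H = 13 \<and> r = 0" "H = 13 \<and> r = 0 \<Longrightarrow> ?M c \<longleftrightarrow> c = 12"
    if "one_in_each S0 Sp \<psi>1 \<psi>2" for c
  proof -
    have "3 + \<epsilon> * H > 0" "frame_sqk 0 0 \<psi>1 \<and> frame_sqk (1 * Q / 2) (- \<kappa> / 2) \<psi>2 \<or>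
        frame_sqk (1 * Q / 2) (- \<kappa> / 2) \<psi>1 \<and> frame_sqk 0 0 \<psi>2"
      using that imp0 impp unfolding one_in_each_def by auto
    from constant_nonconstant_pair[OF this(1) _ nz this(2)] show
      "?C \<longleftrightarrow> H = 13 \<and> r = 0" "H = 13 \<and> r = 0 \<Longrightarrow> ?M c \<longleftrightarrow> c = 12"
      using \<epsilon>r by auto
  qed
  have c0m: "?C \<longleftrightarrow> H = -13 \<and> r = 1" "H = -13 \<and> r = 1 \<Longrightarrow> ?M c \<longleftrightarrow> c = 12"
    if "one_in_each S0 Sm \<psi>1 \<psi>2" for c
  proof -
    have "3 + \<epsilon> * H > 0" "frame_sqk 0 0 \<psi>1 \<and> frame_sqk (-1 * Q / 2) (- \<kappa> / 2) \<psi>2 \<or>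
        frame_sqk (-1 * Q / 2) (- \<kappa> / 2) \<psi>1 \<and> frame_sqk 0 0 \<psi>2"
      using that imp0 impm unfolding one_in_each_def by auto
    from constant_nonconstant_pair[OF this(1) _ nz this(2)] show
      "?C \<longleftrightarrow> H = -13 \<and> r = 1" "H = -13 \<and> r = 1 \<Longrightarrow> ?M c \<longleftrightarrow> c = 12"
      using \<epsilon>r by auto
  qed
  have Q2: "Q = 2 \<longleftrightarrow> 3 + \<epsilon> * H = 4"
    unfolding Q_def using real_sqrt_eq_iff[of "3 + \<epsilon> * H" 4] by simp
  have cpp: "3 + \<epsilon> * H > 0" "?C" "?M c \<longleftrightarrow> 3 + \<epsilon> * H = 4 \<and> r = 1 \<and> c = -4"
    if "\<psi>1 \<in> Sp" "\<psi>2 \<in> Sp" for c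
  proof -
    show pos: "3 + \<epsilon> * H > 0" using impp that by blast
    have "?M c \<longleftrightarrow> \<epsilon> * (Q / 2) = -1 \<and> c = -4"
      using impp[OF that(1)] impp[OF that(2)] kappa_eq(1)[OF pos] nz by (intro maxwell_same_type) auto
    \<comment> \<open>As Q > 0, the sign forces \<epsilon> = -1: two spinors of the plus class solve
      the Maxwell equation only in the Lorentzian case, two of the minus class only in the
      Riemannian one.\<close>
    also have "\<epsilon> * (Q / 2) = -1 \<longleftrightarrow> 3 + \<epsilon> * H = 4 \<and> r = 1"
      using Q2 epsilon_cases kappa_eq(1)[OF pos] by auto
    finally show "?M c \<longleftrightarrow> 3 + \<epsilon> * H = 4 \<and> r = 1 \<and> c = -4" by simp
    show ?C
      using closed2_F_form_iff impp[OF that(1)] impp[OF that(2)] by fastforce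
  qed
  have cmm: "3 + \<epsilon> * H > 0" "?C" "?M c \<longleftrightarrow> 3 + \<epsilon> * H = 4 \<and> r = 0 \<and> c = -4"
    if "\<psi>1 \<in> Sm" "\<psi>2 \<in> Sm" for c
  proof -
    show pos: "3 + \<epsilon> * H > 0" using impm that by blast
    have "?M c \<longleftrightarrow> \<epsilon> * (- Q / 2) = -1 \<and> c = -4"
      using impm[OF that(1)] impm[OF that(2)] kappa_eq(1)[OF pos] nz by (intro maxwell_same_type) auto
    also have "\<epsilon> * (- Q / 2) = -1 \<longleftrightarrow> 3 + \<epsilon> * H = 4 \<and> r = 0"
      using Q2 epsilon_cases kappa_eq(1)[OF pos] by auto
    finally show "?M c \<longleftrightarrow> 3 + \<epsilon> * H = 4 \<and> r = 0 \<and> c = -4" by simp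
    show ?C
      using closed2_F_form_iff impm[OF that(1)] impm[OF that(2)] by fastforce
  qed
  have cpm: "\<not> ?C" if "one_in_each Sp Sm \<psi>1 \<psi>2"
  proof -
    have pos: "3 + \<epsilon> * H > 0" using that impp impm unfolding one_in_each_def by blast
    have ne: "Q / 2 \<noteq> - Q / 2" "- Q / 2 \<noteq> Q / 2" using kappa_eq(1)[OF pos] by auto
    show ?thesis
      using that unfolding one_in_each_def
    proof (elim disjE conjE)
      assume "\<psi>1 \<in> Sp" "\<psi>2 \<in> Sm"
      then show ?thesis
        using closed2_F_form_distinct_iff[OF _ nz(1) _ nz(2) ne(1)] impp impm kappa_eq(1)[OF pos] by fastforce
    next
      assume "\<psi>1 \<in> Sm" "\<psi>2 \<in> Sp"
      then show ?thesis
        using closed2_F_form_distinct_iff[OF _ nz(1) _ nz(2) ne(2)] impp impm kappa_eq(1)[OF pos] by fastforce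
    qed
  qed
  consider (zero_zero) "\<psi>1 \<in> S0" "\<psi>2 \<in> S0" | (zero_plus) "one_in_each S0 Sp \<psi>1 \<psi>2"
    | (zero_minus) "one_in_each S0 Sm \<psi>1 \<psi>2"
    | (plus_plus) "\<psi>1 \<in> Sp" "\<psi>2 \<in> Sp"
    | (minus_minus) "\<psi>1 \<in> Sm" "\<psi>2 \<in> Sm" | (plus_minus) "one_in_each Sp Sm \<psi>1 \<psi>2"
    using \<psi>1(1) \<psi>2(1) unfolding one_in_each_def by blast
  then show ?thesis
  proof cases
    case zero_zero
    then have m: "\<psi>1 \<notin> Sp" "\<psi>1 \<notin> Sm" "\<psi>2 \<notin> Sp" "\<psi>2 \<notin> Sm" using dis1 dis2 by blast+
    show ?thesis
      unfolding Let_def K one_in_each_def \<epsilon>_def[symmetric] H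
      by (simp only: zero_zero m simp_thms c00(1,2)[OF zero_zero])
        (intro conjI impI allI; erule c00(3-5)[OF zero_zero])
  next
    case zero_plus
    then have dis: "\<psi>1 \<in> S0 \<and> \<psi>1 \<notin> Sp \<and> \<psi>1 \<notin> Sm \<and> \<psi>2 \<notin> S0 \<and> \<psi>2 \<in> Sp \<and> \<psi>2 \<notin> Sm \<or>
        \<psi>1 \<notin> S0 \<and> \<psi>1 \<in> Sp \<and> \<psi>1 \<notin> Sm \<and> \<psi>2 \<in> S0 \<and> \<psi>2 \<notin> Sp \<and> \<psi>2 \<notin> Sm"
      unfolding one_in_each_def using dis1 dis2 by blast
    have ex: "H = 13 \<and> r = 0 \<Longrightarrow> \<exists>c. ?M c"
      using c0p(2)[OF zero_plus] by blast
    from dis show ?thesis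
      unfolding Let_def K one_in_each_def \<epsilon>_def[symmetric] H
      using c0p[OF zero_plus] ex by (elim disjE conjE; simp only: simp_thms; blast)
  next
    case zero_minus
    then have dis: "\<psi>1 \<in> S0 \<and> \<psi>1 \<notin> Sp \<and> \<psi>1 \<notin> Sm \<and> \<psi>2 \<notin> S0 \<and> \<psi>2 \<notin> Sp \<and> \<psi>2 \<in> Sm \<or>
        \<psi>1 \<notin> S0 \<and> \<psi>1 \<notin> Sp \<and> \<psi>1 \<in> Sm \<and> \<psi>2 \<in> S0 \<and> \<psi>2 \<notin> Sp \<and> \<psi>2 \<notin> Sm"
      unfolding one_in_each_def using dis1 dis2 by blast
    have ex: "H = -13 \<and> r = 1 \<Longrightarrow> \<exists>c. ?M c"
      using c0m(2)[OF zero_minus] by blast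
    from dis show ?thesis
      unfolding Let_def K one_in_each_def \<epsilon>_def[symmetric] H
      using c0m[OF zero_minus] ex by (elim disjE conjE; simp only: simp_thms; blast)
  next
    case plus_plus
    then have m: "\<psi>1 \<notin> S0" "\<psi>1 \<notin> Sm" "\<psi>2 \<notin> S0" "\<psi>2 \<notin> Sm" using dis1 dis2 by blast+
    have ex: "(\<exists>c. ?M c) \<longleftrightarrow> 3 + \<epsilon> * H = 4 \<and> r = 1"
      using cpp(3)[OF plus_plus] by blast
    show ?thesis
      unfolding Let_def K one_in_each_def \<epsilon>_def[symmetric] H
      by (simp only: plus_plus m simp_thms cpp(1,2)[OF plus_plus] ex) (use cpp(3)[OF plus_plus] in blast)
  next
    case minus_minus
    then have m: "\<psi>1 \<notin> S0" "\<psi>1 \<notin> Sp" "\<psi>2 \<notin> S0" "\<psi>2 \<notin> Sp" using dis1 dis2 by blast+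
    have ex: "(\<exists>c. ?M c) \<longleftrightarrow> 3 + \<epsilon> * H = 4 \<and> r = 0"
      using cmm(3)[OF minus_minus] by blast
    show ?thesis
      unfolding Let_def K one_in_each_def \<epsilon>_def[symmetric] H
      by (simp only: minus_minus m simp_thms cmm(1,2)[OF minus_minus] ex) (use cmm(3)[OF minus_minus] in blast)
  next
    case plus_minus
    then have "\<psi>1 \<notin> S0" "\<psi>2 \<notin> S0" "\<not> (\<psi>1 \<in> Sp \<and> \<psi>2 \<in> Sp)" "\<not> (\<psi>1 \<in> Sm \<and> \<psi>2 \<in> Sm)"
      unfolding one_in_each_def using dis1 dis2 by blast+
    then show ?thesis
      unfolding Let_def K one_in_each_def \<epsilon>_def[symmetric] H
      using cpm[OF plus_minus] by blast
  qed
qed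

end
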